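(* Let $c,A_0,\dots,A_n,D_1,\dots,D_n$ be polynomial data and $d\in\mathbb{N}$. Consider the problem $$u_d=\sup\Big\{\int_0^1\langle c(t),x(t)\rangle\,dt\ :\ x\in\mathbf{L}^n,\ \int_0^1\mathrm{Tr}\big(Fx(t)P(t)\big)\,dt\ge0\ \text{ for all } P\in\mathbf{S}^+_d\Big\}.$$ Let $$\hat d=\max\Big\{\deg(c),\ \max_{1\le i\le n}\big(d+\deg(A_i)\big),\ \max_{1\le i\le n}\big(d+1+\deg(D_i)\big)\Big\}.$$ Then the optimal value $u_d$ does not change when $\mathbf{L}^n$ is replaced with $\mathbb{R}^n_{\hat d}[t]$. Moreover, $u_d$ equals the optimal value of the semidefinite program $$\max_{x\in\mathbb{R}^n_{\hat d}[t]}\ \int_0^1\langle c(t),x(t)\rangle\,dt\quad\text{subject to}\quad (\alpha_d^m)^*(Fx)\succeq0,\quad(\beta_d^m)^*(Fx)\succeq0 .$$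
   Context: $\mathbf{L}^n$ is the set of measurable functions $x:[0,1]\to\mathbb{R}^n$ with $\sup_{t,i}|x_i(t)|<\infty$. $\mathbb{R}^n_{e}[t]$ is the set of vectors of $n$ real polynomials in $t$ of degree at most $e$. The data are: $c$, a vector of $n$ univariate real polynomials; $A_0,\dots,A_n$, symmetric $m\times m$ matrices whose entries are real polynomials in $t$; $D_1,\dots,D_n$, symmetric $m\times m$ matrices whose entries are real polynomials in $(t,s)$. The degree of a polynomial vector or matrix is the maximum (total) degree of its entries; identically zero data are ignored in the maximum defining $\hat d$ (and $\hat d=0$ if nothing remains). For $x\in\mathbf{L}^n$, $$Fx(t)=A_0(t)+\sum_{i=1}^n x_i(t)A_i(t)+\sum_{i=1}^n\int_0^t x_i(s)D_i(t,s)\,ds.$$ $\mathbf{S}^+_d$ is the set of symmetric $m\times m$ matrices $P$ whose entries are real polynomials in $t$ of degree at most $d$ and such that $P(t)$ is positive semidefinite for all $t\in[0,1]$. $M\succeq0$ means positive semidefinite. For an even integer $e\ge0$ and a bounded measurable function $P$ from $[0,1]$ to symmetric $m\times m$ matrices, $(\Lambda_e^m)^*(P)$ is the constant symmetric matrix of size $(\frac e2+1)m$ with rows and columns indexed by pairs $(i,k)$, $1\le i\le m$, $0\le k\le\frac e2$, and entries $$(\Lambda_e^m)^*(P)_{(i,k),(j,l)}=\int_0^1t^{k+l}P_{ij}(t)\,dt.$$ Then - if $d$ is odd: $(\alpha_d^m)^*(P)=(\Lambda_{d-1}^m)^*(tP)$ and $(\beta_d^m)^*(P)=(\Lambda_{d-1}^m)^*((1-t)P)$;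 - if $d$ is even: $(\alpha_d^m)^*(P)=(\Lambda_d^m)^*(P)$ and $(\beta_d^m)^*(P)=(\Lambda_{d-2}^m)^*(t(1-t)P)$ (for $d=0$ the constraint involving $(\beta_0^m)^*$ is absent). Optimal values are suprema in $[-\infty,+\infty]$, with the supremum over the empty set equal to $-\infty$. *)

theory Defs
  imports "HOL-Analysis.Analysis" "HOL-Computational_Algebra.Polynomial"
begin

text \<open>
  A polynomial in \<open>(t, s)\<close> is a \<^typ>\<open>real poly poly\<close>, with outer variable \<open>s\<close> and
  coefficients in \<open>t\<close>.
\<close>

definition poly_ts :: "real poly poly \<Rightarrow> real \<Rightarrow> real \<Rightarrow> real" where
  "poly_ts p t s = poly (poly p [:s:]) t"

definition total_degree :: "real poly poly \<Rightarrow> nat" where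
  "total_degree p = Max (insert 0 ((\<lambda>k. k + degree (coeff p k)) ` {k. coeff p k \<noteq> 0}))"

definition vec_eval :: "real poly ^ 'n \<Rightarrow> real \<Rightarrow> real ^ 'n" where
  "vec_eval p t = (\<chi> i. poly (p $ i) t)"

definition mat_eval :: "real poly ^ 'm ^ 'm \<Rightarrow> real \<Rightarrow> real ^ 'm ^ 'm" where
  "mat_eval M t = (\<chi> i j. poly (M $ i $ j) t)"

definition mat_eval_ts :: "real poly poly ^ 'm ^ 'm \<Rightarrow> real \<Rightarrow> real \<Rightarrow> real ^ 'm ^ 'm" where
  "mat_eval_ts M t s = (\<chi> i j. poly_ts (M $ i $ j) t s)"

definition vec_degree :: "real poly ^ 'n \<Rightarrow> nat" where
  "vec_degree p = (MAX i. degree (p $ i))"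

definition mat_degree :: "real poly ^ 'm ^ 'm \<Rightarrow> nat" where
  "mat_degree M = (MAX (i, j). degree (M $ i $ j))"

definition mat_total_degree :: "real poly poly ^ 'm ^ 'm \<Rightarrow> nat" where
  "mat_total_degree M = (MAX (i, j). total_degree (M $ i $ j))"

text \<open>
  Only the values on \<open>[0,1]\<close> of the functions in the next two sets are ever used.
  Measurability and all integrals below refer to Lebesgue (not just Borel) measurable functions.
\<close>

definition Lvec :: "(real \<Rightarrow> real ^ 'n) set" where
  "Lvec = {x. x \<in> borel_measurable (lebesgue_on {0..1}) \<and>
              (\<exists>B. \<forall>t\<in>{0..1}. \<forall>i. \<bar>x t $ i\<bar> \<le> B)}"

definition polyvec :: "nat \<Rightarrow> (real \<Rightarrow> real ^ 'n) set" where
  "polyvec e = {vec_eval p | p. \<forall>i. degree (p $ i) \<le> e}"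

text \<open>
  Matrices whose size varies are pairs of a finite index set and the entries.
\<close>

type_synonym 'i fmat = "'i set \<times> ('i \<Rightarrow> 'i \<Rightarrow> real)"

definition psd :: "'i fmat \<Rightarrow> bool" where
  "psd = (\<lambda>(I, M). (\<forall>p\<in>I. \<forall>q\<in>I. M p q = M q p) \<and>
     (\<forall>v :: 'i \<Rightarrow> real. 0 \<le> (\<Sum>p\<in>I. \<Sum>q\<in>I. v p * M p q * v q)))"

definition fmat_of :: "real ^ 'm ^ 'm \<Rightarrow> 'm fmat" where
  "fmat_of M = (UNIV, \<lambda>i j. M $ i $ j)"

definition Splus :: "nat \<Rightarrow> (real poly ^ 'm ^ 'm) set" where
  "Splus d = {P. transpose P = P \<and> (\<forall>i j. degree (P $ i $ j) \<le> d) \<and>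
                 (\<forall>t\<in>{0..1}. psd (fmat_of (mat_eval P t)))}"

definition F_op ::
  "real poly ^ 'm ^ 'm \<Rightarrow> ('n \<Rightarrow> real poly ^ 'm ^ 'm) \<Rightarrow> ('n \<Rightarrow> real poly poly ^ 'm ^ 'm) \<Rightarrow>
   (real \<Rightarrow> real ^ 'n) \<Rightarrow> real \<Rightarrow> real ^ 'm ^ 'm" where
  "F_op A0 A D x t = mat_eval A0 t + (\<Sum>i\<in>UNIV. x t $ i *\<^sub>R mat_eval (A i) t) +
     (\<Sum>i\<in>UNIV. LINT s:{0..t}|lebesgue. x s $ i *\<^sub>R mat_eval_ts (D i) t s)"

definition objective :: "real poly ^ 'n \<Rightarrow> (real \<Rightarrow> real ^ 'n) \<Rightarrow> real" where
  "objective c x = (LINT t:{0..1}|lebesgue. vec_eval c t \<bullet> x t)"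

definition u_value ::
  "real poly ^ 'n \<Rightarrow> real poly ^ 'm ^ 'm \<Rightarrow> ('n \<Rightarrow> real poly ^ 'm ^ 'm) \<Rightarrow>
   ('n \<Rightarrow> real poly poly ^ 'm ^ 'm) \<Rightarrow> nat \<Rightarrow> (real \<Rightarrow> real ^ 'n) set \<Rightarrow> ereal" where
  "u_value c A0 A D d X =
     (SUP x \<in> {x \<in> X. \<forall>P\<in>Splus d.
                 0 \<le> (LINT t:{0..1}|lebesgue. trace (F_op A0 A D x t ** mat_eval P t))}.
        ereal (objective c x))"

definition d_hat ::
  "real poly ^ 'n \<Rightarrow> ('n \<Rightarrow> real poly ^ 'm ^ 'm) \<Rightarrow> ('n \<Rightarrow> real poly poly ^ 'm ^ 'm) \<Rightarrow>
   nat \<Rightarrow> nat" where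
  "d_hat c A D d = Max ({0} \<union> (if c = 0 then {} else {vec_degree c}) \<union>
     {d + mat_degree (A i) | i. A i \<noteq> 0} \<union>
     {d + 1 + mat_total_degree (D i) | i. D i \<noteq> 0})"

definition Lambda_adj :: "nat \<Rightarrow> (real \<Rightarrow> real ^ 'm ^ 'm) \<Rightarrow> ('m \<times> nat) fmat" where
  "Lambda_adj e P = (UNIV \<times> {0..e div 2},
     \<lambda>(i, k) (j, l). LINT t:{0..1}|lebesgue. t ^ (k + l) * P t $ i $ j)"

definition alpha_adj :: "nat \<Rightarrow> (real \<Rightarrow> real ^ 'm ^ 'm) \<Rightarrow> ('m \<times> nat) fmat" where
  "alpha_adj d P = (if odd d then Lambda_adj (d - 1) (\<lambda>t. t *\<^sub>R P t) else Lambda_adj d P)"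

text \<open>
  At \<open>d = 0\<close> the value of \<open>beta_adj\<close> is meaningless (\<open>d - 2\<close> truncates);
  \<open>sdp_value\<close> does not use it.
\<close>

definition beta_adj :: "nat \<Rightarrow> (real \<Rightarrow> real ^ 'm ^ 'm) \<Rightarrow> ('m \<times> nat) fmat" where
  "beta_adj d P = (if odd d then Lambda_adj (d - 1) (\<lambda>t. (1 - t) *\<^sub>R P t)
                   else Lambda_adj (d - 2) (\<lambda>t. (t * (1 - t)) *\<^sub>R P t))"

definition sdp_value ::
  "real poly ^ 'n \<Rightarrow> real poly ^ 'm ^ 'm \<Rightarrow> ('n \<Rightarrow> real poly ^ 'm ^ 'm) \<Rightarrow>
   ('n \<Rightarrow> real poly poly ^ 'm ^ 'm) \<Rightarrow> nat \<Rightarrow> ereal" where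
  "sdp_value c A0 A D d =
     (SUP x \<in> {x \<in> polyvec (d_hat c A D d).
                 psd (alpha_adj d (F_op A0 A D x)) \<and>
                 (d > 0 \<longrightarrow> psd (beta_adj d (F_op A0 A D x)))}.
        ereal (objective c x))"

end

theory Submission imports Defs
begin

text \<open>
  The objective and, for each \<open>P\<close>, the constraint \<open>\<integral> Tr (Fx P)\<close> depend on \<open>x\<close> through integrals
  \<open>\<integral> q x\<^sub>i\<close> with polynomial weights \<open>q\<close>, plus a constant. For the Volterra term this follows from
  Fubini: if \<open>Q' = q\<close>, then
  \<open>\<integral>\<^sub>0\<^sup>1 q(t) \<integral>\<^sub>0\<^sup>t s\<^sup>k x\<^sub>i(s) ds dt = \<integral>\<^sub>0\<^sup>1 x\<^sub>i(s) s\<^sup>k (Q(1) - Q(s)) ds\<close>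
  (\<open>integral_poly_times_primitive\<close>). All the weights have degree at most \<open>d_hat\<close>, so
  only the moments of \<open>x\<^sub>i\<close> up to that order matter (\<open>values_determined_by_moments\<close>), and
  the \<open>L\<^sup>2\<close>-projection of \<open>x\<^sub>i\<close> to polynomials of degree at most \<open>d_hat\<close> has the same ones
  (\<open>moment_projection\<close>).

  For the semidefinite program, the matrix inequalities say that the functional
  \<open>P \<mapsto> \<integral> Tr (Fx P)\<close> is nonnegative on the matrices \<open>w q q\<^sup>T\<close>, where \<open>q\<close> is a vector of
  polynomials and \<open>w\<close> is one of the weights \<open>1\<close>, \<open>t(1-t)\<close> (for even \<open>d\<close>) or \<open>t\<close>, \<open>1-t\<close> (for odd
  \<open>d\<close>). These matrices are in \<open>Splus d\<close>, so one direction is immediate. The other one is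
  the matrix version of the theorem of Lukacs on polynomials that are nonnegative on an interval.
  It is proved here for the functional, without decomposing any \<open>P\<close>
  (\<open>nonneg_on_psd_polynomials_unit_interval\<close>):

  \<^item> The substitution \<open>t = x\<^sup>2 / (1 + x\<^sup>2)\<close> turns the functional into a sequence of
    matrix moments \<open>g n\<close> on the real line, and its nonnegativity on weighted squares becomes
    positive semidefiniteness of the block Hankel matrix \<open>(g (i + j))\<close>, \<open>i, j \<le> d\<close>.
  \<^item> If this matrix is positive definite, then diagonalizing it simultaneously with the shifted
    matrix \<open>(g (i + j + 1))\<close> gives numbers \<open>l\<^sub>r\<close> and vectors \<open>w\<^sub>r\<close> with
    \<open>g n = (\<Sum>r. l\<^sub>r ^ n w\<^sub>r w\<^sub>r\<^sup>T)\<close> for \<open>n \<le> 2 d\<close>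
    (\<open>posdef_hankel_imp_atomic\<close>). This is Gauss quadrature with matrix weights: the functional
    is a sum of evaluations \<open>P \<mapsto> w\<^sub>r\<^sup>T P w\<^sub>r\<close> at real points, which are nonnegative on
    positive semidefinite \<open>P\<close>.
  \<^item> The semidefinite case follows by a small perturbation of the moments.
\<close>

section \<open>Simultaneous diagonalization of two quadratic forms\<close>

definition vmul :: "'i set \<Rightarrow> ('i \<Rightarrow> 'i \<Rightarrow> real) \<Rightarrow> ('i \<Rightarrow> real) \<Rightarrow> 'i \<Rightarrow> real" where
  "vmul I M v q = (\<Sum>p\<in>I. v p * M p q)"

definition bform :: "'i set \<Rightarrow> ('i \<Rightarrow> 'i \<Rightarrow> real) \<Rightarrow> ('i \<Rightarrow> real) \<Rightarrow> ('i \<Rightarrow> real) \<Rightarrow> real" where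
  "bform I M v w = (\<Sum>q\<in>I. vmul I M v q * w q)"

definition symm :: "('i \<Rightarrow> 'i \<Rightarrow> real) \<Rightarrow> bool" where
  "symm M \<longleftrightarrow> (\<forall>p q. M p q = M q p)"

text \<open>
  Only the coordinates in \<open>I\<close> count, so the finite index set can shrink in an induction.
\<close>

definition posdef :: "'i set \<Rightarrow> ('i \<Rightarrow> 'i \<Rightarrow> real) \<Rightarrow> bool" where
  "posdef I M \<longleftrightarrow> (\<forall>v. (\<exists>p\<in>I. v p \<noteq> 0) \<longrightarrow> 0 < bform I M v v)"

lemma bform_double_sum: "bform I M v w = (\<Sum>p\<in>I. \<Sum>q\<in>I. v p * M p q * w q)"
  unfolding bform_def vmul_def by (subst sum.swap) (simp add: sum_distrib_right)

lemma bform_commute: "symm M \<Longrightarrow> bform I M v w = bform I M w v"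
  unfolding bform_double_sum symm_def by (subst sum.swap) (simp add: mult_ac)

lemma vmul_linear: "vmul I M (\<lambda>p. a * v p + b * w p) q = a * vmul I M v q + b * vmul I M w q"
  by (simp add: vmul_def sum_distrib_left sum.distrib algebra_simps)

lemma bform_linear_left:
  "bform I M (\<lambda>p. a * v p + b * w p) z = a * bform I M v z + b * bform I M w z"
  by (simp add: bform_def vmul_linear sum_distrib_left sum.distrib algebra_simps)

lemma bform_linear_right:
  "bform I M z (\<lambda>p. a * v p + b * w p) = a * bform I M z v + b * bform I M z w"
  by (simp add: bform_def sum_distrib_left sum.distrib algebra_simps)

lemma bform_combination:
  assumes "symm M"
  shows "bform I M (\<lambda>p. a * v p + b * w p) (\<lambda>p. a * v p + b * w p)
    = a\<^sup>2 * bform I M v v + 2 * a * b * bform I M v w + b\<^sup>2 * bform I M w w"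
  by (simp add: bform_linear_left bform_linear_right bform_commute[OF assms, of I w v]
      power2_eq_square algebra_simps)

lemma bform_scale: "bform I M (\<lambda>p. a * v p) (\<lambda>p. a * v p) = a\<^sup>2 * bform I M v v"
  using bform_linear_left[of I M a v 0 v "\<lambda>p. a * v p"] bform_linear_right[of I M v a v 0 v]
  by (simp add: power2_eq_square)

lemma bform_unit: "finite I \<Longrightarrow> q \<in> I \<Longrightarrow> bform I M v (\<lambda>p. of_bool (p = q)) = vmul I M v q"
  by (simp add: bform_def of_bool_def if_distrib[of "(*) _"] cong: if_cong)

text \<open>
  Otherwise the form would become negative on moving from the isotropic vector \<open>v\<close> along the
  \<open>q\<close>-th coordinate axis.
\<close>

lemma psd_isotropic_imp_kernel:
  fixes v :: "'i \<Rightarrow> real"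
  assumes I: "finite I" and sym: "symm M" and nonneg: "\<And>w. 0 \<le> bform I M w w"
    and iso: "bform I M v v = 0" and q: "q \<in> I"
  shows "vmul I M v q = 0"
proof -
  define e :: "'i \<Rightarrow> real" where "e p = of_bool (p = q)" for p
  define b c where "b = vmul I M v q" and "c = bform I M e e"
  have c: "0 \<le> c" by (simp add: c_def nonneg)
  have b: "bform I M v e = b" using bform_unit[OF I q, of M v] by (simp add: b_def e_def[abs_def])
  \<comment> \<open>The factors \<open>c + 1\<close> and \<open>- b\<close> minimize the form on the line through \<open>v\<close>, up to scaling and
    the \<open>1\<close> that keeps the first one positive.\<close>
  have "0 \<le> 2 * (c + 1) * (- b) * b + b\<^sup>2 * c"
    using nonneg[of "\<lambda>p. (c + 1) * v p + (- b) * e p"]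
    unfolding bform_combination[OF sym] b iso by (simp add: c_def)
  then have "(c + 2) * b\<^sup>2 \<le> 0" by (simp add: power2_eq_square algebra_simps)
  with c have "b\<^sup>2 \<le> 0" by (smt (verit) mult_nonneg_nonneg mult_pos_pos zero_le_power2)
  then show ?thesis by (simp add: b_def)
qed

text \<open>
  The maximum \<open>l\<close> of the Rayleigh quotient \<open>H(v,v) / G(v,v)\<close> on the unit sphere is attained at
  some \<open>v\<close>. The form \<open>l G - H\<close> is then nonnegative and vanishes at \<open>v\<close>, so \<open>v\<close> is in its kernel.
\<close>

lemma exists_generalized_eigenvector:
  assumes I: "finite I" "I \<noteq> {}" and sym: "symm G" "symm H" and pd: "posdef I G"
  shows "\<exists>v l. (\<exists>p\<in>I. v p \<noteq> 0) \<and> (\<forall>q\<in>I. vmul I H v q = l * vmul I G v q)"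
proof -
  define K where "K = PiE UNIV (\<lambda>p. if p \<in> I then {-1..1::real} else {0}) \<inter> {v. (\<Sum>p\<in>I. (v p)\<^sup>2) = 1}"
  have "compact (PiE UNIV (\<lambda>p::'a. if p \<in> I then {-1..1::real} else {0}))"
    unfolding compactin_euclidean_iff[symmetric] euclidean_product_topology[symmetric] compactin_PiE
    by simp
  moreover have "closed {v::'a\<Rightarrow>real. (\<Sum>p\<in>I. (v p)\<^sup>2) = 1}"
    by (intro closed_Collect_eq continuous_intros continuous_on_product_coordinates)
  ultimately have "compact K" unfolding K_def by (rule compact_Int_closed)
  obtain p0 where p0: "p0 \<in> I" using I by blast
  have ne: "(\<lambda>p. of_bool (p = p0)) \<in> K" using p0 I by (auto simp: K_def PiE_iff if_distrib[of "\<lambda>x. x\<^sup>2"] of_bool_def cong: if_cong)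
  have nz: "\<exists>p\<in>I. v p \<noteq> 0" if "v \<in> K" for v
  proof (rule ccontr)
    assume "\<not> ?thesis"
    then have "(\<Sum>p\<in>I. (v p)\<^sup>2) = 0" by simp
    with that show False by (simp add: K_def)
  qed
  have pos: "0 < bform I G v v" if "v \<in> K" for v
    using pd nz[OF that] by (auto simp: posdef_def)
  have cont: "continuous_on K (\<lambda>v. bform I M v v)" for M
    unfolding bform_double_sum by (intro continuous_intros continuous_on_subset[OF continuous_on_product_coordinates]) auto
  have "continuous_on K (\<lambda>v. bform I H v v / bform I G v v)"
    using pos by (intro continuous_on_divide cont) force
  then obtain v where v: "v \<in> K"
    and max: "\<And>w. w \<in> K \<Longrightarrow> bform I H w w / bform I G w w \<le> bform I H v v / bform I G v v"
    using continuous_attains_sup[OF \<open>compact K\<close>] ne by blast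
  define l where "l = bform I H v v / bform I G v v"
  define N where "N p q = l * G p q - H p q" for p q
  have vmul_N: "vmul I N w q = l * vmul I G w q - vmul I H w q" for w q
    by (simp add: vmul_def N_def sum_distrib_left sum_subtractf algebra_simps)
  have N: "bform I N w z = l * bform I G w z - bform I H w z" for w z
    by (simp add: bform_def vmul_N sum_distrib_left sum_subtractf algebra_simps)
  have "0 \<le> bform I N w w" for w
  proof (cases "\<exists>p\<in>I. w p \<noteq> 0")
    case False
    then show ?thesis by (simp add: bform_double_sum)
  next
    case True
    define s where "s = (\<Sum>p\<in>I. (w p)\<^sup>2)"
    have s: "0 < s" unfolding s_def using True I
      by (metis (no_types, lifting) sum_pos2 zero_le_power2 zero_less_power2)
    define w' where "w' p = (if p \<in> I then w p / sqrt s else 0)" for p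
    have sum1: "(\<Sum>p\<in>I. (w' p)\<^sup>2) = 1"
      using s by (simp add: w'_def power_divide sum_divide_distrib[symmetric] s_def[symmetric])
    have "- 1 \<le> w' p \<and> w' p \<le> 1" if "p \<in> I" for p
    proof -
      have "(w' p)\<^sup>2 \<le> (\<Sum>p\<in>I. (w' p)\<^sup>2)" using that I by (intro member_le_sum) auto
      then have "\<bar>w' p\<bar> \<le> 1" using sum1 by (simp add: abs_square_le_1)
      then show ?thesis by linarith
    qed
    moreover have "w' p = 0" if "p \<notin> I" for p using that by (simp add: w'_def)
    ultimately have "w' \<in> K" using sum1 by (auto simp: K_def PiE_iff)
    from max[OF this] pos[OF this] have "0 \<le> bform I N w' w'"
      by (simp add: N l_def[symmetric] field_simps)
    moreover have "bform I N w w = (sqrt s)\<^sup>2 * bform I N w' w'"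
      unfolding bform_scale[symmetric] using s by (auto simp: bform_double_sum w'_def)
    ultimately show ?thesis using s by simp
  qed
  moreover have "bform I N v v = 0" using pos[OF v] by (simp add: N l_def)
  moreover have "symm N" using sym by (auto simp: symm_def N_def)
  ultimately have "vmul I N v q = 0" if "q \<in> I" for q
    using psd_isotropic_imp_kernel[OF I(1)] that by blast
  then have "\<forall>q\<in>I. vmul I H v q = l * vmul I G v q" by (simp add: vmul_N)
  with nz[OF v] show ?thesis by blast
qed

lemma vmul_restrict:
  assumes "finite I" "J \<subseteq> I" "\<And>p. p \<in> I - J \<Longrightarrow> v p = 0"
  shows "vmul I M v q = vmul J M v q"
  unfolding vmul_def using assms by (intro sum.mono_neutral_right) auto

lemma bform_restrict:
  assumes "finite I" "J \<subseteq> I" "\<And>p. p \<in> I - J \<Longrightarrow> v p = 0" "\<And>p. p \<in> I - J \<Longrightarrow> w p = 0"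
  shows "bform I M v w = bform J M v w"
proof -
  have "bform I M v w = (\<Sum>q\<in>J. vmul I M v q * w q)"
    unfolding bform_def using assms by (intro sum.mono_neutral_right) auto
  moreover have "vmul I M v q = vmul J M v q" for q
    using assms(1-3) by (rule vmul_restrict)
  ultimately show ?thesis by (simp add: bform_def)
qed

text \<open>
  The vectors \<open>f r\<close> form a \<open>G\<close>-orthonormal basis of generalized eigenvectors; what is stated is
  the eigenvalue equation and Parseval's identity, which is all that a moment representation needs.
  The proof splits off one normalized eigenvector \<open>v\<close>: \<open>G\<close> and \<open>H\<close> are reduced by
  multiples of \<open>g g\<^sup>T\<close>, where \<open>g = G v\<close>, so that \<open>v\<close> lies in the kernel of both.
  On the coordinates other than some \<open>p0\<close> with \<open>v p0 \<noteq> 0\<close> the reduced \<open>G\<close> is still positive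
  definite, and what the induction hypothesis gives there extends to \<open>p0\<close> because a functional
  that annihilates \<open>v\<close> is determined by the other coordinates.
\<close>

theorem simultaneous_diagonalization:
  assumes "finite I" "symm G" "symm H" "posdef I G"
  shows "\<exists>f l. (\<forall>r\<in>I. \<forall>q\<in>I. vmul I H (f r) q = l r * vmul I G (f r) q) \<and>
    (\<forall>p\<in>I. \<forall>q\<in>I. G p q = (\<Sum>r\<in>I. vmul I G (f r) p * vmul I G (f r) q))"
  using assms
proof (induction I arbitrary: G H rule: finite_psubset_induct)
  case (psubset I)
  show ?case
  proof (cases "I = {}")
    case False
    note I = \<open>finite I\<close> and symG = \<open>symm G\<close> and symH = \<open>symm H\<close> and pd = \<open>posdef I G\<close>
    obtain v0 l0 where v0: "\<exists>p\<in>I. v0 p \<noteq> 0" and eig0: "\<And>q. q \<in> I \<Longrightarrow> vmul I H v0 q = l0 * vmul I G v0 q"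
      using exists_generalized_eigenvector[OF I False symG symH pd] by blast
    have pos0: "0 < bform I G v0 v0" using pd v0 by (auto simp: posdef_def)
    define s where "s = 1 / sqrt (bform I G v0 v0)"
    define v where "v p = s * v0 p" for p
    have s: "s \<noteq> 0" using pos0 by (simp add: s_def)
    obtain p0 where p0: "p0 \<in> I" "v p0 \<noteq> 0" using v0 s by (auto simp: v_def)
    have vmul_v: "vmul I M v q = s * vmul I M v0 q" for M q
      by (simp add: vmul_def v_def sum_distrib_left mult_ac)
    have eig: "vmul I H v q = l0 * vmul I G v q" if "q \<in> I" for q
      using eig0[OF that] by (simp add: vmul_v)
    have norm: "bform I G v v = 1"
      unfolding v_def bform_scale using pos0 by (simp add: s_def power_divide)
    define g where "g = vmul I G v"
    have gv: "(\<Sum>q\<in>I. g q * v q) = 1" using norm by (simp add: bform_def g_def)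
    have g': "vmul I M v q = (\<Sum>p\<in>I. M q p * v p)" if "symm M" for M q
      using that by (auto simp: vmul_def symm_def intro!: sum.cong mult.commute)
    define G1 H1 where "G1 p q = G p q - g p * g q" and "H1 p q = H p q - l0 * (g p * g q)" for p q
    have sym1: "symm G1" "symm H1" using symG symH by (auto simp: symm_def G1_def H1_def)
    have vmul_G1: "vmul I G1 w q = vmul I G w q - bform I G v w * g q" for w q
      by (simp add: vmul_def G1_def bform_def g_def[symmetric] sum_subtractf sum_distrib_left sum_distrib_right algebra_simps)
    have vmul_H1: "vmul I H1 w q = vmul I H w q - l0 * bform I G v w * g q" for w q
      by (simp add: vmul_def H1_def bform_def g_def[symmetric] sum_subtractf sum_distrib_left sum_distrib_right algebra_simps)
    have kill: "(\<Sum>q\<in>I. vmul I G1 w q * v q) = 0" "(\<Sum>q\<in>I. vmul I H1 w q * v q) = 0" for w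
    proof -
      have "(\<Sum>q\<in>I. vmul I G1 w q * v q) = bform I G w v - bform I G v w * (\<Sum>q\<in>I. g q * v q)"
        by (simp add: vmul_G1 bform_def[of I G w v] sum_subtractf sum_distrib_left algebra_simps)
      then show "(\<Sum>q\<in>I. vmul I G1 w q * v q) = 0" using gv bform_commute[OF symG] by simp
      have "(\<Sum>q\<in>I. vmul I H1 w q * v q) = bform I H w v - l0 * bform I G v w * (\<Sum>q\<in>I. g q * v q)"
        by (simp add: vmul_H1 bform_def[of I H w v] sum_subtractf sum_distrib_left algebra_simps)
      also have "bform I H w v = l0 * bform I G v w"
        unfolding bform_commute[OF symH, of I w v]
        by (simp add: bform_def eig sum_distrib_left mult_ac)
      finally show "(\<Sum>q\<in>I. vmul I H1 w q * v q) = 0" using gv by simp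
    qed
    define J where "J = I - {p0}"
    have J: "J \<subset> I" "J \<subseteq> I" "I = insert p0 J" "p0 \<notin> J" "finite J" using p0 I by (auto simp: J_def)
    \<comment> \<open>Applied in each argument, to the eigenvalue equation and to Parseval's identity.\<close>
    have extend: "phi p0 = 0" if "(\<Sum>q\<in>I. phi q * v q) = 0" "\<And>q. q \<in> J \<Longrightarrow> phi q = 0" for phi :: "'a \<Rightarrow> real"
      using that p0 J by simp
    have "posdef J G1"
      unfolding posdef_def
    proof (intro allI impI)
      fix w0 :: "'a \<Rightarrow> real" assume w0: "\<exists>p\<in>J. w0 p \<noteq> 0"
      define w where "w p = (if p \<in> J then w0 p else 0)" for p
      define k where "k = bform I G v w"
      \<comment> \<open>The reduced form at \<open>w\<close> is \<open>G\<close> at the part of \<open>w\<close> that is \<open>G\<close>-orthogonal to \<open>v\<close>.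
        This part is not \<open>0\<close>, since \<open>w\<close> vanishes at \<open>p0\<close> and \<open>v\<close> does not.\<close>
      have "bform J G1 w0 w0 = bform J G1 w w" unfolding bform_double_sum by (intro sum.cong) (auto simp: w_def)
      also have "\<dots> = bform I G1 w w" using I J(2) by (intro bform_restrict[symmetric]) (auto simp: w_def)
      also have "\<dots> = bform I G w w - k * k"
      proof -
        have "bform I G1 w w = bform I G w w - k * (\<Sum>q\<in>I. g q * w q)"
          unfolding bform_def[of I G1] bform_def[of I G w] vmul_G1 k_def[symmetric]
          by (simp add: sum_subtractf sum_distrib_left algebra_simps)
        also have "(\<Sum>q\<in>I. g q * w q) = k" by (simp add: k_def bform_def g_def)
        finally show ?thesis .
      qed
      also have "\<dots> = bform I G (\<lambda>p. 1 * w p + (- k) * v p) (\<lambda>p. 1 * w p + (- k) * v p)"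
        unfolding bform_combination[OF symG] norm bform_commute[OF symG, of I w v] k_def[symmetric]
        by (simp add: power2_eq_square)
      also have "\<dots> > 0"
      proof -
        have "\<exists>p\<in>I. 1 * w p + (- k) * v p \<noteq> 0"
        proof (cases "k = 0")
          case True
          then show ?thesis using w0 J(2) by (auto simp: w_def)
        next
          case False
          then show ?thesis using p0 J(4) by (intro bexI[of _ p0]) (auto simp: w_def)
        qed
        then show ?thesis by (rule pd[unfolded posdef_def, rule_format])
      qed
      finally show "0 < bform J G1 w0 w0" .
    qed
    from psubset.IH[OF J(1) sym1 this]
    obtain f' l' where *: "(\<forall>r\<in>J. \<forall>q\<in>J. vmul J H1 (f' r) q = l' r * vmul J G1 (f' r) q) \<and>
      (\<forall>p\<in>J. \<forall>q\<in>J. G1 p q = (\<Sum>r\<in>J. vmul J G1 (f' r) p * vmul J G1 (f' r) q))"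
      by (elim exE)
    have eig': "\<And>r q. r \<in> J \<Longrightarrow> q \<in> J \<Longrightarrow> vmul J H1 (f' r) q = l' r * vmul J G1 (f' r) q"
      using conjunct1[OF *] by blast
    have
      pars': "\<And>p q. p \<in> J \<Longrightarrow> q \<in> J \<Longrightarrow> G1 p q = (\<Sum>r\<in>J. vmul J G1 (f' r) p * vmul J G1 (f' r) q)"
      using conjunct2[OF *] by blast
    define f0 where "f0 r p = (if p \<in> J then f' r p else 0)" for r p
    have f0: "vmul J M (f' r) q = vmul I M (f0 r) q" for M r q
    proof -
      have "vmul I M (f0 r) q = vmul J M (f0 r) q" using I J by (intro vmul_restrict) (auto simp: f0_def)
      then show ?thesis by (simp add: vmul_def f0_def)
    qed
    \<comment> \<open>Subtracting the component along \<open>v\<close> makes \<open>G\<close> and \<open>H\<close> act on the eigenvector as the reduced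
      forms do; \<open>v\<close> itself takes the index \<open>p0\<close>.\<close>
    define f where "f r = (if r = p0 then v else (\<lambda>p. 1 * f0 r p + (- bform I G v (f0 r)) * v p))" for r
    define l where "l r = (if r = p0 then l0 else l' r)" for r
    have fG: "vmul I G (f r) q = vmul I G1 (f0 r) q" if "r \<in> J" for r q
    proof -
      have fr: "f r = (\<lambda>p. 1 * f0 r p + (- bform I G v (f0 r)) * v p)" using that J(4) by (auto simp: f_def)
      show ?thesis unfolding fr vmul_linear vmul_G1 by (simp add: g_def)
    qed
    have fH: "vmul I H (f r) q = vmul I H1 (f0 r) q" if "r \<in> J" "q \<in> I" for r q
    proof -
      have fr: "f r = (\<lambda>p. 1 * f0 r p + (- bform I G v (f0 r)) * v p)" using that J(4) by (auto simp: f_def)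
      show ?thesis unfolding fr vmul_linear vmul_H1 eig[OF that(2)] by (simp add: g_def)
    qed
    have eigJ: "vmul I H1 (f0 r) q - l' r * vmul I G1 (f0 r) q = 0" if r: "r \<in> J" and q: "q \<in> I" for r q
    proof (cases "q = p0")
      case True
      have "(\<Sum>q\<in>I. (vmul I H1 (f0 r) q - l' r * vmul I G1 (f0 r) q) * v q) = 0"
        using kill[of "f0 r"] by (simp add: left_diff_distrib sum_subtractf mult.assoc sum_distrib_left[symmetric])
      from extend[OF this] show ?thesis using True eig'[OF r] by (simp add: f0)
    next
      case False
      then show ?thesis using q eig'[OF r, of q] J by (auto simp: f0)
    qed
    \<comment> \<open>The defect in Parseval's identity annihilates \<open>v\<close> in either argument.\<close>
    define Del where "Del p q = G1 p q - (\<Sum>r\<in>J. vmul I G1 (f0 r) p * vmul I G1 (f0 r) q)" for p q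
    have Del_sym: "Del p q = Del q p" for p q using sym1 by (simp add: Del_def symm_def mult_ac)
    have Del_v: "(\<Sum>q\<in>I. Del p q * v q) = 0" for p
    proof -
      have "(\<Sum>q\<in>I. Del p q * v q) = (\<Sum>q\<in>I. G1 p q * v q) - (\<Sum>r\<in>J. vmul I G1 (f0 r) p * (\<Sum>q\<in>I. vmul I G1 (f0 r) q * v q))"
        unfolding Del_def left_diff_distrib sum_subtractf sum_distrib_left sum_distrib_right
        by (subst sum.swap) (simp add: mult_ac)
      also have "(\<Sum>q\<in>I. G1 p q * v q) = vmul I G1 v p" using g'[OF sym1(1)] by simp
      also have "\<dots> = 0" by (simp add: vmul_G1 norm g_def)
      finally show ?thesis by (simp add: kill)
    qed
    have Del_JJ: "Del p q = 0" if "p \<in> J" "q \<in> J" for p q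
      using pars'[OF that] by (simp add: Del_def f0)
    have Del_JI: "Del p q = 0" if "p \<in> J" "q \<in> I" for p q
      using that extend[OF Del_v, of p] Del_JJ[OF that(1)] J(3) by blast
    have Del0: "Del p q = 0" if "p \<in> I" "q \<in> I" for p q
    proof (cases "q = p0")
      case True
      show ?thesis unfolding True using extend[OF Del_v, of p] Del_JI[of _ p] Del_sym[of p] that by auto
    next
      case False
      then have "q \<in> J" using that J by auto
      then show ?thesis using Del_JI[of q p] Del_sym[of p q] that by simp
    qed
    show ?thesis
    proof (intro exI conjI ballI)
      fix r q assume "r \<in> I" "q \<in> I"
      then show "vmul I H (f r) q = l r * vmul I G (f r) q"
        using eigJ[of r q] J fG[of r q] fH[of r q] eig[of q] by (cases "r = p0") (auto simp: l_def f_def)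
    next
      fix p q assume pq: "p \<in> I" "q \<in> I"
      have "(\<Sum>r\<in>I. vmul I G (f r) p * vmul I G (f r) q) = g p * g q + (\<Sum>r\<in>J. vmul I G (f r) p * vmul I G (f r) q)"
        using J by (simp add: f_def g_def)
      also have "\<dots> = g p * g q + (\<Sum>r\<in>J. vmul I G1 (f0 r) p * vmul I G1 (f0 r) q)"
        by (simp add: fG)
      also have "\<dots> = G p q" using Del0[OF pq] by (simp add: Del_def G1_def)
      finally show "G p q = (\<Sum>r\<in>I. vmul I G (f r) p * vmul I G (f r) q)" by simp
    qed
  qed auto
qed

section \<open>Truncated matrix moments on the real line\<close>

text \<open>
  An index \<open>(a, i)\<close> stands for the monomial \<open>t ^ i\<close> in the \<open>a\<close>-th component of a vector of
  polynomials, so that a vector indexed by such pairs is a polynomial vector.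
\<close>

definition hankel :: "(nat \<Rightarrow> 'm \<Rightarrow> 'm \<Rightarrow> real) \<Rightarrow> 'm \<times> nat \<Rightarrow> 'm \<times> nat \<Rightarrow> real" where
  "hankel g = (\<lambda>(a, i) (b, j). g (i + j) a b)"

text \<open>
  Diagonalize the Hankel form \<open>G\<close> together with the shifted form \<open>H\<close>, the form of multiplication
  by the variable. For \<open>i < d\<close>, the \<open>(a, i)\<close> column of \<open>H\<close> is the \<open>(a, i + 1)\<close> column of \<open>G\<close>,
  so the coordinate functionals \<open>u r = G (f r)\<close> satisfy \<open>u r (a, i + 1) = l r * u r (a, i)\<close>, and
  Parseval's identity is the claim. The moment \<open>g (2 * d + 1)\<close> enters \<open>H\<close> as the free parameter of
  a Gauss quadrature.
\<close>

lemma posdef_hankel_imp_atomic: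
  fixes g :: "nat \<Rightarrow> 'm::finite \<Rightarrow> 'm \<Rightarrow> real"
  assumes sym: "\<And>n a b. g n a b = g n b a"
    and pd: "posdef (UNIV \<times> {0..d}) (hankel g)"
  obtains l :: "'m \<times> nat \<Rightarrow> real" and w :: "'m \<times> nat \<Rightarrow> 'm \<Rightarrow> real"
  where "\<And>n a b. n \<le> 2 * d \<Longrightarrow> g n a b = (\<Sum>r\<in>UNIV \<times> {0..d}. l r ^ n * (w r a * w r b))"
proof -
  define I where "I = (UNIV :: 'm set) \<times> {0..d}"
  define H where "H = hankel (\<lambda>n. g (Suc n))"
  have "symm (hankel g)" "symm H"
    by (auto simp: symm_def H_def hankel_def add.commute intro: sym)
  moreover have "finite I" "posdef I (hankel g)" using pd by (auto simp: I_def)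
  ultimately obtain f l where
    *: "(\<forall>r\<in>I. \<forall>q\<in>I. vmul I H (f r) q = l r * vmul I (hankel g) (f r) q) \<and>
      (\<forall>p\<in>I. \<forall>q\<in>I. hankel g p q = (\<Sum>r\<in>I. vmul I (hankel g) (f r) p * vmul I (hankel g) (f r) q))"
    using simultaneous_diagonalization[of I "hankel g" H] by blast
  define u where "u r = vmul I (hankel g) (f r)" for r
  have step: "u r (a, Suc i) = l r * u r (a, i)" if "r \<in> I" "i < d" for r a i
  proof -
    have "hankel g p (a, Suc i) = H p (a, i)" for p
      by (auto simp: H_def hankel_def split: prod.split)
    then have "u r (a, Suc i) = vmul I H (f r) (a, i)" by (simp add: u_def vmul_def)
    also have "\<dots> = l r * u r (a, i)"
      using conjunct1[OF *] that by (auto simp: u_def I_def)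
    finally show ?thesis .
  qed
  have pow: "u r (a, i) = l r ^ i * u r (a, 0)" if "r \<in> I" "i \<le> d" for r a i
    using that(2) by (induction i) (auto simp: step[OF that(1)] mult_ac)
  show thesis
  proof
    fix n a b assume n: "n \<le> 2 * d"
    define i where "i = min n d"
    have i: "i \<le> d" "n - i \<le> d" "i + (n - i) = n" using n by (auto simp: i_def)
    have "g n a b = hankel g (a, i) (b, n - i)" by (simp add: hankel_def i)
    also have "\<dots> = (\<Sum>r\<in>I. u r (a, i) * u r (b, n - i))"
      using conjunct2[OF *] i(1,2) by (auto simp: u_def I_def)
    also have "\<dots> = (\<Sum>r\<in>I. l r ^ n * (u r (a, 0) * u r (b, 0)))"
    proof (intro sum.cong refl)
      fix r assume "r \<in> I"
      have "l r ^ n = l r ^ i * l r ^ (n - i)" using i(3) by (metis power_add)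
      then show "u r (a, i) * u r (b, n - i) = l r ^ n * (u r (a, 0) * u r (b, 0))"
        using pow[OF \<open>r \<in> I\<close> i(1)] pow[OF \<open>r \<in> I\<close> i(2)] by (simp add: mult_ac)
    qed
    finally show "g n a b = (\<Sum>r\<in>UNIV \<times> {0..d}. l r ^ n * (u r (a, 0) * u r (b, 0)))"
      by (simp add: I_def)
  qed
qed

lemma coeffs_zero_if_values_zero:
  fixes v :: "nat \<Rightarrow> real"
  assumes "\<And>r. r \<le> d \<Longrightarrow> (\<Sum>i=0..d. v i * real r ^ i) = 0" "i \<le> d"
  shows "v i = 0"
proof -
  define p where "p = (\<Sum>i=0..d. monom (v i) i)"
  have "degree p \<le> d" unfolding p_def
    by (intro degree_sum_le) (auto intro: order.trans[OF degree_monom_le])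
  have val: "poly p x = (\<Sum>i=0..d. v i * x ^ i)" for x by (simp add: p_def poly_sum poly_monom)
  have "p = 0"
  proof (rule ccontr)
    assume "p \<noteq> 0"
    have "card (real ` {0..d}) \<le> card {x. poly p x = 0}"
      using assms(1) poly_roots_finite[OF \<open>p \<noteq> 0\<close>] by (intro card_mono) (auto simp: val)
    then show False using card_poly_roots_bound[OF \<open>p \<noteq> 0\<close>] \<open>degree p \<le> d\<close>
      by (simp add: card_image inj_on_def)
  qed
  moreover have "coeff p i = v i" using assms(2) by (simp add: p_def coeff_sum)
  ultimately show ?thesis by simp
qed

text \<open>
  Adding a small multiple of the moments \<open>c\<close> of the point masses (times the unit matrix) at
  \<open>0, \<dots>, d\<close> makes the Hankel form positive definite, because a polynomial of degree at most \<open>d\<close> is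
  determined by its values at \<open>d + 1\<close> points. The atomic representation of the perturbed
  moments turns the sum into values of the quadratic form of \<open>C\<close> at the atoms.
\<close>

theorem psd_hankel_nonneg_on_psd_polynomials:
  fixes g C :: "nat \<Rightarrow> 'm::finite \<Rightarrow> 'm \<Rightarrow> real"
  assumes sym: "\<And>n a b. g n a b = g n b a"
    and psd: "\<And>v. 0 \<le> bform (UNIV \<times> {0..d}) (hankel g) v v"
    and C: "\<And>x w. 0 \<le> (\<Sum>n=0..2*d. x ^ n * (\<Sum>a\<in>UNIV. \<Sum>b\<in>UNIV. C n a b * (w a * w b)))"
  shows "0 \<le> (\<Sum>n=0..2*d. \<Sum>a\<in>UNIV. \<Sum>b\<in>UNIV. C n a b * g n a b)"
proof -
  define c where "c n a b = (\<Sum>r=0..d. real r ^ n) * of_bool (a = b)" for n and a b :: 'm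
  let ?I = "(UNIV :: 'm set) \<times> {0..d}"
  have form_c: "bform ?I (hankel c) v v = (\<Sum>a\<in>UNIV. \<Sum>r=0..d. (\<Sum>i=0..d. v (a, i) * real r ^ i)\<^sup>2)" for v
  proof -
    have "bform ?I (hankel c) v v = (\<Sum>a\<in>UNIV. \<Sum>i=0..d. \<Sum>b\<in>UNIV. \<Sum>j=0..d.
        v (a, i) * ((\<Sum>r=0..d. real r ^ (i + j)) * of_bool (a = b)) * v (b, j))"
      by (simp add: bform_double_sum hankel_def c_def sum.cartesian_product')
    also have "\<dots> = (\<Sum>a\<in>UNIV. \<Sum>i=0..d. \<Sum>j=0..d. v (a, i) * (\<Sum>r=0..d. real r ^ (i + j)) * v (a, j))"
    proof (intro sum.cong refl)
      fix a i
      show "(\<Sum>b\<in>UNIV. \<Sum>j=0..d. v (a, i) * ((\<Sum>r=0..d. real r ^ (i + j)) * of_bool (a = b)) * v (b, j))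
        = (\<Sum>j=0..d. v (a, i) * (\<Sum>r=0..d. real r ^ (i + j)) * v (a, j))"
        by (subst sum.swap)
          (simp add: of_bool_def if_distrib[of "(*) _"] if_distrib[of "\<lambda>x. x * _"] cong: if_cong)
    qed
    also have "\<dots> = (\<Sum>a\<in>UNIV. \<Sum>i=0..d. \<Sum>j=0..d. \<Sum>r=0..d. v (a, i) * real r ^ i * (v (a, j) * real r ^ j))"
      by (simp add: sum_distrib_left sum_distrib_right power_add mult_ac)
    also have "\<dots> = (\<Sum>a\<in>UNIV. \<Sum>i=0..d. \<Sum>r=0..d. \<Sum>j=0..d. v (a, i) * real r ^ i * (v (a, j) * real r ^ j))"
      by (intro sum.cong refl sum.swap)
    also have "\<dots> = (\<Sum>a\<in>UNIV. \<Sum>r=0..d. \<Sum>i=0..d. \<Sum>j=0..d. v (a, i) * real r ^ i * (v (a, j) * real r ^ j))"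
      by (intro sum.cong refl sum.swap)
    finally show ?thesis by (simp add: power2_eq_square sum_product)
  qed
  have perturbed: "0 \<le> (\<Sum>n=0..2*d. \<Sum>a\<in>UNIV. \<Sum>b\<in>UNIV. C n a b * (g n a b + e * c n a b))"
    if e: "0 < e" for e :: real
  proof -
    let ?g = "\<lambda>n a b. g n a b + e * c n a b"
    have add: "bform ?I (hankel ?g) v v = bform ?I (hankel g) v v + e * bform ?I (hankel c) v v" for v
      by (simp add: bform_double_sum hankel_def case_prod_unfold sum.distrib sum_distrib_left algebra_simps)
    have "posdef ?I (hankel ?g)"
      unfolding posdef_def
    proof (intro allI impI)
      fix v assume "\<exists>p\<in>?I. v p \<noteq> (0::real)"
      then obtain a i where ai: "i \<le> d" "v (a, i) \<noteq> 0" by auto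
      obtain r where r: "r \<le> d" "(\<Sum>i=0..d. v (a, i) * real r ^ i) \<noteq> 0"
        using coeffs_zero_if_values_zero[of d "\<lambda>i. v (a, i)" i] ai by auto
      have "0 < bform ?I (hankel c) v v"
        unfolding form_c
        by (intro sum_pos2[where i = a] sum_pos2[where i = r] sum_nonneg) (use r in auto)
      then show "0 < bform ?I (hankel ?g) v v" using psd[of v] e by (simp add: add add_nonneg_pos)
    qed
    moreover have "?g n a b = ?g n b a" for n a b using sym by (auto simp: c_def)
    ultimately obtain l :: "'m \<times> nat \<Rightarrow> real" and w :: "'m \<times> nat \<Rightarrow> 'm \<Rightarrow> real"
      where at: "\<And>n a b. n \<le> 2 * d \<Longrightarrow> ?g n a b = (\<Sum>r\<in>?I. l r ^ n * (w r a * w r b))"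
      using posdef_hankel_imp_atomic[of ?g d] by blast
    have "(\<Sum>n=0..2*d. \<Sum>a\<in>UNIV. \<Sum>b\<in>UNIV. C n a b * ?g n a b) =
      (\<Sum>n=0..2*d. \<Sum>a\<in>UNIV. \<Sum>b\<in>UNIV. \<Sum>r\<in>?I. l r ^ n * (C n a b * (w r a * w r b)))"
      by (intro sum.cong refl) (simp add: at sum_distrib_left mult_ac)
    also have "\<dots> = (\<Sum>r\<in>?I. \<Sum>n=0..2*d. \<Sum>a\<in>UNIV. \<Sum>b\<in>UNIV. l r ^ n * (C n a b * (w r a * w r b)))"
      by (simp only: sum.swap[of _ ?I])
    also have "\<dots> \<ge> 0"
    proof (rule sum_nonneg)
      fix r
      show "0 \<le> (\<Sum>n=0..2*d. \<Sum>a\<in>UNIV. \<Sum>b\<in>UNIV. l r ^ n * (C n a b * (w r a * w r b)))"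
        using C[of "l r" "w r"] by (simp add: sum_distrib_left)
    qed
    finally show ?thesis .
  qed
  let ?S = "\<Sum>n=0..2*d. \<Sum>a\<in>UNIV. \<Sum>b\<in>UNIV. C n a b * g n a b"
  let ?T = "\<Sum>n=0..2*d. \<Sum>a\<in>UNIV. \<Sum>b\<in>UNIV. C n a b * c n a b"
  have "(\<lambda>e. ?S + e * ?T) \<midarrow>0\<rightarrow> ?S + 0 * ?T" by (intro tendsto_intros)
  then have "((\<lambda>e. ?S + e * ?T) \<longlongrightarrow> ?S) (at_right 0)" by (simp add: filterlim_at_split)
  moreover have "\<forall>\<^sub>F e in at_right 0. 0 \<le> ?S + e * ?T"
    using perturbed by (auto simp: eventually_at_right_field sum.distrib sum_distrib_left algebra_simps intro!: exI[of _ 1])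
  ultimately show ?thesis by (rule tendsto_lowerbound) simp
qed

section \<open>Functionals that are nonnegative on weighted squares over the unit interval\<close>

text \<open>
  The Bernstein basis without its binomial factors; at \<open>t = x\<^sup>2 / (1 + x\<^sup>2)\<close> it takes the values
  \<open>x ^ (2 * j) / (1 + x\<^sup>2) ^ d\<close>.
\<close>

definition bern :: "nat \<Rightarrow> nat \<Rightarrow> real poly" where
  "bern d j = [:0, 1:] ^ j * [:1, -1:] ^ (d - j)"

lemma poly_bern: "poly (bern d j) t = t ^ j * (1 - t) ^ (d - j)"
  by (simp add: bern_def poly_power)

text \<open>
  Subtracting a multiple of \<open>t ^ d\<close> makes the polynomial vanish at \<open>1\<close>, and \<open>1 - t\<close> can then be split off.
\<close>

lemma bernstein_expansion:
  assumes "degree p \<le> d"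
  shows "\<exists>c. p = (\<Sum>j=0..d. smult (c j) (bern d j))"
  using assms
proof (induction d arbitrary: p)
  case 0
  then obtain a where "p = [:a:]" using degree_eq_zeroE by blast
  then show ?case by (intro exI[of _ "\<lambda>_. a"]) (simp add: bern_def one_pCons)
next
  case (Suc d)
  define k where "k = poly p 1"
  define p1 where "p1 = p - smult k (bern (Suc d) (Suc d))"
  have "poly p1 1 = 0" by (simp add: p1_def k_def poly_bern)
  then obtain r where r: "p1 = [:1, -1:] * r"
    unfolding poly_eq_0_iff_dvd using minus_dvd_iff[of "[:-1, 1:]" p1] by (auto simp: dvd_def)
  have "degree p1 \<le> Suc d" using Suc.prems
    by (auto simp: p1_def bern_def intro!: degree_diff_le order.trans[OF degree_smult_le] order.trans[OF degree_power_le])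
  then have "degree r \<le> d" using degree_mult_eq[of "[:1, -1:]" r] r by (cases "r = 0") simp_all
  from Suc.IH[OF this] obtain c where c: "r = (\<Sum>j=0..d. smult (c j) (bern d j))" by blast
  have "p = [:1, -1:] * r + smult k (bern (Suc d) (Suc d))" using r by (simp add: p1_def algebra_simps)
  also have "[:1, -1:] * r = (\<Sum>j=0..d. smult (c j) (bern (Suc d) j))"
  proof -
    have "[:1, -1:] * bern d j = bern (Suc d) j" if "j \<le> d" for j
      by (simp only: bern_def Suc_diff_le[OF that] power_Suc mult_ac)
    then show ?thesis unfolding c sum_distrib_left mult_smult_right by (intro sum.cong) auto
  qed
  finally show ?case by (intro exI[of _ "\<lambda>j. if j = Suc d then k else c j"]) simp
qed

lemma degree_bern: "j \<le> d \<Longrightarrow> degree (bern d j) = d"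
  by (simp add: bern_def degree_mult_eq degree_power_eq)

lemma half_le_half_diff_parity: "a div 2 \<le> (d - a mod 2) div 2" if "a \<le> d" for a d :: nat
  using that by presburger

text \<open>
  The outer index is the parity; for \<open>d = 0\<close> there are no odd indices, whence the \<open>min\<close>.
\<close>

lemma sum_split_parity:
  "(\<Sum>i=0..d. f i) = (\<Sum>c=0..min 1 d. \<Sum>x=0..(d - c) div 2. f (2 * x + c))" for d :: nat
  unfolding sum.Sigma[OF finite_atLeastAtMost ballI[OF finite_atLeastAtMost]]
  by (intro sum.reindex_bij_witness[where i = "\<lambda>(c, x). 2 * x + c" and j = "\<lambda>i. (i mod 2, i div 2)"])
     (auto simp: min_def half_le_half_diff_parity split: if_splits)

text \<open>
  With \<open>t = x\<^sup>2 / (1 + x\<^sup>2)\<close>, a polynomial of degree at most \<open>d\<close> in \<open>t\<close> is \<open>(1 + x\<^sup>2) ^ -d\<close>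
  times an even polynomial of degree at most \<open>2 * d\<close> in \<open>x\<close>. So let the even moments on the line
  be the values of \<open>L\<close> on the basis \<open>bern d\<close>, and let the odd ones be \<open>0\<close>. In the Hankel form, indices of
  different parity then do not interact: the even ones (\<open>c = 0\<close>) and the odd ones (\<open>c = 1\<close>) each
  give the value of \<open>L\<close> on one weighted square, with weight
  \<open>t ^ c * (1 - t) ^ ((d - c) mod 2)\<close>.
\<close>

theorem nonneg_on_psd_polynomials_unit_interval:
  fixes L :: "real poly \<Rightarrow> 'm::finite \<Rightarrow> 'm \<Rightarrow> real" and P :: "'m \<Rightarrow> 'm \<Rightarrow> real poly"
  assumes L_add: "\<And>p q a b. L (p + q) a b = L p a b + L q a b"
    and L_smult: "\<And>k p a b. L (smult k p) a b = k * L p a b"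
    and L_sym: "\<And>p a b. L p a b = L p b a"
    and squares: "\<And>c q. c \<le> min 1 d \<Longrightarrow> (\<And>a. degree (q a) \<le> (d - c) div 2) \<Longrightarrow>
      0 \<le> (\<Sum>a\<in>UNIV. \<Sum>b\<in>UNIV. L ([:0, 1:] ^ c * [:1, -1:] ^ ((d - c) mod 2) * (q a * q b)) a b)"
    and deg: "\<And>a b. degree (P a b) \<le> d"
    and psd: "\<And>t w. 0 \<le> t \<Longrightarrow> t \<le> 1 \<Longrightarrow> 0 \<le> (\<Sum>a\<in>UNIV. \<Sum>b\<in>UNIV. poly (P a b) t * (w a * w b))"
  shows "0 \<le> (\<Sum>a\<in>UNIV. \<Sum>b\<in>UNIV. L (P a b) a b)"
proof -
  have L_0: "L 0 a b = 0" for a b using L_smult[of 0 0] by simp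
  have L_sum: "L (\<Sum>i\<in>A. F i) a b = (\<Sum>i\<in>A. L (F i) a b)" for F :: "nat \<Rightarrow> real poly" and A a b
    by (induction A rule: infinite_finite_induct) (auto simp: L_0 L_add)
  define g where "g n a b = (if even n then L (bern d (n div 2)) a b else 0)" for n a b
  obtain c where c: "\<And>a b. P a b = (\<Sum>j=0..d. smult (c a b j) (bern d j))"
    using bernstein_expansion[OF deg] by metis
  define C where "C n a b = (if even n then c a b (n div 2) else 0)" for n a b
  have even_sum: "(\<Sum>n=0..2*d. if even n then f (n div 2) else 0) = (\<Sum>j=0..d. f j)" for f :: "nat \<Rightarrow> real"
    by (subst sum.inter_filter[symmetric], simp)
      (intro sum.reindex_bij_witness[where i = "\<lambda>j. 2 * j" and j = "\<lambda>n. n div 2"]; auto)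

  have "0 \<le> (\<Sum>n=0..2*d. \<Sum>a\<in>UNIV. \<Sum>b\<in>UNIV. C n a b * g n a b)"
  proof (rule psd_hankel_nonneg_on_psd_polynomials)
    show "g n a b = g n b a" for n a b by (simp add: g_def L_sym)
  next
    fix v :: "'m \<times> nat \<Rightarrow> real"
    \<comment> \<open>The part of \<open>v\<close> of parity \<open>k\<close>, read as a vector of polynomials in \<open>t\<close> of degree at most
      \<open>(d - k) div 2\<close>; the remaining factors of \<open>bern d\<close> form the weight.\<close>
    define q where "q k a = (\<Sum>x=0..(d - k) div 2. smult (v (a, 2 * x + k)) (bern ((d - k) div 2) x))" for k a
    have q: "degree (q k a) \<le> (d - k) div 2" for k a
      unfolding q_def
      by (intro degree_sum_le order.trans[OF degree_smult_le]) (auto simp: degree_bern)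
    have expand: "(\<Sum>i=0..d. \<Sum>j=0..d. v (a, i) * g (i + j) a b * v (b, j)) =
      (\<Sum>k=0..min 1 d. L ([:0, 1:] ^ k * [:1, -1:] ^ ((d - k) mod 2) * (q k a * q k b)) a b)" for a b
    proof -
      have "(\<Sum>i=0..d. \<Sum>j=0..d. v (a, i) * g (i + j) a b * v (b, j)) =
        (\<Sum>k=0..min 1 d. \<Sum>x=0..(d - k) div 2. \<Sum>k'=0..min 1 d. \<Sum>y=0..(d - k') div 2.
          v (a, 2 * x + k) * g (2 * x + k + (2 * y + k')) a b * v (b, 2 * y + k'))"
        by (simp only: sum_split_parity[of _ d])
      also have "\<dots> = (\<Sum>k=0..min 1 d. \<Sum>x=0..(d - k) div 2. \<Sum>k'=0..min 1 d.
          if k' = k then \<Sum>y=0..(d - k) div 2.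
            v (a, 2 * x + k) * L (bern d (x + y + k)) a b * v (b, 2 * y + k) else 0)"
      proof (intro sum.cong refl)
        fix k x k' assume "k \<in> {0..min 1 d}" "k' \<in> {0..min 1 d}"
        then have k: "k \<le> 1" "k' \<le> 1" by auto
        have "g (2 * x + k + (2 * y + k')) a b = (if k' = k then L (bern d (x + y + k)) a b else 0)" for y
          using k by (auto simp: g_def le_Suc_eq)
        then show "(\<Sum>y=0..(d - k') div 2. v (a, 2 * x + k) * g (2 * x + k + (2 * y + k')) a b * v (b, 2 * y + k'))
          = (if k' = k then \<Sum>y=0..(d - k) div 2.
            v (a, 2 * x + k) * L (bern d (x + y + k)) a b * v (b, 2 * y + k) else 0)" by simp
      qed
      also have "\<dots> = (\<Sum>k=0..min 1 d. \<Sum>x=0..(d - k) div 2. \<Sum>y=0..(d - k) div 2.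
            v (a, 2 * x + k) * L (bern d (x + y + k)) a b * v (b, 2 * y + k))"
        by (rule sum.cong[OF refl], rule sum.cong[OF refl]) (simp add: sum.delta)
      also have "\<dots> = (\<Sum>k=0..min 1 d. L ([:0, 1:] ^ k * [:1, -1:] ^ ((d - k) mod 2) * (q k a * q k b)) a b)"
      proof (intro sum.cong refl)
        fix k assume k: "k \<in> {0..min 1 d}"
        let ?K = "(d - k) div 2"
        have bern: "[:0, 1:] ^ k * [:1, -1:] ^ ((d - k) mod 2) * (bern ?K x * bern ?K y) = bern d (x + y + k)"
          if "x \<le> ?K" "y \<le> ?K" for x y
        proof -
          have half: "d' - (x + y) = d' mod 2 + ((K - x) + (K - y))"
            if "x \<le> K" "y \<le> K" "d' = d' mod 2 + 2 * K" for d' K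
            using that by arith
          have "d - (x + y + k) = (d - k) - (x + y)" by simp
          then have "d - (x + y + k) = (d - k) mod 2 + ((?K - x) + (?K - y))"
            using half[OF that, of "d - k"] by simp
          then show ?thesis by (simp add: bern_def power_add mult_ac)
        qed
        have "[:0, 1:] ^ k * [:1, -1:] ^ ((d - k) mod 2) * (q k a * q k b) =
          (\<Sum>x=0..?K. \<Sum>y=0..?K. smult (v (a, 2 * x + k) * v (b, 2 * y + k))
             ([:0, 1:] ^ k * [:1, -1:] ^ ((d - k) mod 2) * (bern ?K x * bern ?K y)))"
          unfolding q_def sum_product by (simp add: sum_distrib_left mult.commute)
        also have "\<dots> = (\<Sum>x=0..?K. \<Sum>y=0..?K. smult (v (a, 2 * x + k) * v (b, 2 * y + k)) (bern d (x + y + k)))"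
          by (intro sum.cong refl arg_cong[where f = "smult _"] bern) auto
        finally show "(\<Sum>x=0..?K. \<Sum>y=0..?K. v (a, 2 * x + k) * L (bern d (x + y + k)) a b * v (b, 2 * y + k))
          = L ([:0, 1:] ^ k * [:1, -1:] ^ ((d - k) mod 2) * (q k a * q k b)) a b"
          by (simp add: L_sum L_smult mult_ac)
      qed
      finally show ?thesis .
    qed
    have "bform (UNIV \<times> {0..d}) (hankel g) v v =
      (\<Sum>a\<in>UNIV. \<Sum>i=0..d. \<Sum>b\<in>UNIV. \<Sum>j=0..d. v (a, i) * g (i + j) a b * v (b, j))"
      by (simp add: bform_double_sum hankel_def sum.cartesian_product')
    also have "\<dots> = (\<Sum>a\<in>UNIV. \<Sum>b\<in>UNIV. \<Sum>i=0..d. \<Sum>j=0..d. v (a, i) * g (i + j) a b * v (b, j))"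
      by (intro sum.cong refl sum.swap)
    also have "\<dots> = (\<Sum>k=0..min 1 d. \<Sum>a\<in>UNIV. \<Sum>b\<in>UNIV. L ([:0, 1:] ^ k * [:1, -1:] ^ ((d - k) mod 2) * (q k a * q k b)) a b)"
      unfolding expand by (simp only: sum.swap[of _ _ "{0..min 1 d}"])
    also have "\<dots> \<ge> 0" by (intro sum_nonneg squares q) auto
    finally show "0 \<le> bform (UNIV \<times> {0..d}) (hankel g) v v" .
  next
    fix x :: real and w :: "'m \<Rightarrow> real"
    define t where "t = x\<^sup>2 / (1 + x\<^sup>2)"
    have pos: "0 < 1 + x\<^sup>2" by (simp add: add_pos_nonneg)
    have t: "0 \<le> t" "t \<le> 1" "1 - t = 1 / (1 + x\<^sup>2)" using pos by (auto simp: t_def field_simps)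
    have bern: "x ^ (2 * j) = (1 + x\<^sup>2) ^ d * poly (bern d j) t" if "j \<le> d" for j
    proof -
      have "(1 + x\<^sup>2) ^ d = (1 + x\<^sup>2) ^ j * (1 + x\<^sup>2) ^ (d - j)" using that by (simp flip: power_add)
      then show ?thesis using pos
        by (simp add: poly_bern t(3)) (simp add: t_def power_divide power_mult)
    qed
    have "(\<Sum>n=0..2*d. x ^ n * (\<Sum>a\<in>UNIV. \<Sum>b\<in>UNIV. C n a b * (w a * w b))) =
      (\<Sum>n=0..2*d. if even n then x ^ (2 * (n div 2)) * (\<Sum>a\<in>UNIV. \<Sum>b\<in>UNIV. c a b (n div 2) * (w a * w b)) else 0)"
      by (intro sum.cong) (auto simp: C_def)
    also have "\<dots> = (\<Sum>j=0..d. x ^ (2 * j) * (\<Sum>a\<in>UNIV. \<Sum>b\<in>UNIV. c a b j * (w a * w b)))"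
      by (rule even_sum)
    also have "\<dots> = (\<Sum>j=0..d. \<Sum>a\<in>UNIV. \<Sum>b\<in>UNIV. (1 + x\<^sup>2) ^ d * (c a b j * poly (bern d j) t * (w a * w b)))"
    proof (intro sum.cong refl)
      fix j assume "j \<in> {0..d}"
      then show "x ^ (2 * j) * (\<Sum>a\<in>UNIV. \<Sum>b\<in>UNIV. c a b j * (w a * w b)) =
        (\<Sum>a\<in>UNIV. \<Sum>b\<in>UNIV. (1 + x\<^sup>2) ^ d * (c a b j * poly (bern d j) t * (w a * w b)))"
        by (subst bern) (simp_all add: sum_distrib_left mult_ac)
    qed
    also have "\<dots> = (1 + x\<^sup>2) ^ d * (\<Sum>a\<in>UNIV. \<Sum>b\<in>UNIV. poly (P a b) t * (w a * w b))"
      unfolding c poly_sum poly_smult sum_distrib_left sum_distrib_right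
      by (simp only: sum.swap[of _ _ "{0..d}"])
    also have "\<dots> \<ge> 0" using pos psd[OF t(1,2)] by simp
    finally show "0 \<le> (\<Sum>n=0..2*d. x ^ n * (\<Sum>a\<in>UNIV. \<Sum>b\<in>UNIV. C n a b * (w a * w b)))" .
  qed
  also have "\<dots> = (\<Sum>n=0..2*d. if even n then \<Sum>a\<in>UNIV. \<Sum>b\<in>UNIV. c a b (n div 2) * L (bern d (n div 2)) a b else 0)"
    by (intro sum.cong) (auto simp: C_def g_def)
  also have "\<dots> = (\<Sum>j=0..d. \<Sum>a\<in>UNIV. \<Sum>b\<in>UNIV. c a b j * L (bern d j) a b)"
    by (rule even_sum)
  also have "\<dots> = (\<Sum>a\<in>UNIV. \<Sum>b\<in>UNIV. L (P a b) a b)"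
    unfolding c L_sum L_smult by (simp only: sum.swap[of _ "{0..d}"])
  finally show ?thesis .
qed

section \<open>Moments of bounded functions on the unit interval\<close>

abbreviation unit_leb :: "real measure" where "unit_leb \<equiv> lebesgue_on {0..1}"

definition bdd_meas :: "(real \<Rightarrow> real) set" where
  "bdd_meas = {f \<in> borel_measurable unit_leb. \<exists>B. \<forall>t\<in>{0..1}. \<bar>f t\<bar> \<le> B}"

lemma set_integral_unit_leb: "(LINT t:{0..1}|lebesgue. f t) = integral\<^sup>L unit_leb f"
  for f :: "real \<Rightarrow> 'a::euclidean_space"
  by (simp add: set_lebesgue_integral_def integral_restrict_space)

lemma bdd_meas_integrable: "f \<in> bdd_meas \<Longrightarrow> integrable unit_leb f"
proof -
  assume "f \<in> bdd_meas"
  then obtain B where "f \<in> borel_measurable unit_leb" "\<forall>t\<in>{0..1}. \<bar>f t\<bar> \<le> B"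
    unfolding bdd_meas_def by blast
  moreover have "finite_measure unit_leb"
    by (rule finite_measureI) (simp add: emeasure_restrict_space)
  ultimately show ?thesis
    by (intro finite_measure.integrable_const_bound[of _ _ B]) (auto intro!: AE_I2)
qed

lemma bdd_meas_set_integrable: "f \<in> bdd_meas \<Longrightarrow> set_integrable lebesgue {0..1} f"
  using bdd_meas_integrable[of f] by (simp add: set_integrable_def integrable_restrict_space)

lemma bdd_meas_cong:
  assumes "\<And>t. t \<in> {0..1} \<Longrightarrow> f t = g t" shows "f \<in> bdd_meas \<longleftrightarrow> g \<in> bdd_meas"
proof -
  have "f \<in> borel_measurable unit_leb \<longleftrightarrow> g \<in> borel_measurable unit_leb"
    using assms by (intro measurable_cong) simp
  then show ?thesis using assms by (simp add: bdd_meas_def)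
qed

lemma bdd_meas_mult [intro]:
  assumes "f \<in> bdd_meas" "g \<in> bdd_meas" shows "(\<lambda>t. f t * g t) \<in> bdd_meas"
proof -
  obtain B C where "\<forall>t\<in>{0..1}. \<bar>f t\<bar> \<le> B" "\<forall>t\<in>{0..1}. \<bar>g t\<bar> \<le> C"
    using assms unfolding bdd_meas_def by blast
  then have "\<bar>f t * g t\<bar> \<le> B * C" if "t \<in> {0..1}" for t
    unfolding abs_mult using that by (intro mult_mono) (auto intro: order.trans[OF abs_ge_zero])
  moreover have "(\<lambda>t. f t * g t) \<in> borel_measurable unit_leb"
    using assms by (intro borel_measurable_times) (auto simp: bdd_meas_def)
  ultimately show ?thesis unfolding bdd_meas_def by blast
qed

lemma bdd_meas_add [intro]:
  assumes "f \<in> bdd_meas" "g \<in> bdd_meas" shows "(\<lambda>t. f t + g t) \<in> bdd_meas"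
proof -
  obtain B C where "\<forall>t\<in>{0..1}. \<bar>f t\<bar> \<le> B" "\<forall>t\<in>{0..1}. \<bar>g t\<bar> \<le> C"
    using assms unfolding bdd_meas_def by blast
  then have "\<bar>f t + g t\<bar> \<le> B + C" if "t \<in> {0..1}" for t
    using that by (intro order.trans[OF abs_triangle_ineq] add_mono) auto
  moreover have "(\<lambda>t. f t + g t) \<in> borel_measurable unit_leb"
    using assms by (intro borel_measurable_add) (auto simp: bdd_meas_def)
  ultimately show ?thesis unfolding bdd_meas_def by blast
qed

lemma bdd_meas_continuous:
  assumes "continuous_on {0..1} f" shows "f \<in> bdd_meas"
proof -
  have "bounded (f ` {0..1})" using assms by (intro compact_imp_bounded compact_continuous_image) auto
  then show ?thesis using assms
    by (auto simp: bdd_meas_def bounded_iff intro!: continuous_imp_measurable_on_sets_lebesgue)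
qed

lemma bdd_meas_poly [intro]: "poly p \<in> bdd_meas"
  by (intro bdd_meas_continuous continuous_intros)

lemma bdd_meas_const: "(\<lambda>_. k) \<in> bdd_meas"
  by (intro bdd_meas_continuous continuous_intros)

lemma bdd_meas_power [intro]: "(\<lambda>t. t ^ k) \<in> bdd_meas"
  by (intro bdd_meas_continuous continuous_intros)

lemma bdd_meas_sum [intro]: "(\<And>i. i \<in> A \<Longrightarrow> f i \<in> bdd_meas) \<Longrightarrow> (\<lambda>t. \<Sum>i\<in>A. f i t) \<in> bdd_meas"
  by (induction A rule: infinite_finite_induct)
    (auto intro: bdd_meas_const)

definition primitive :: "(real \<Rightarrow> real) \<Rightarrow> real \<Rightarrow> real" where
  "primitive h t = (LINT s:{0..t}|lebesgue. h s)"

text \<open>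
  An indefinite integral is continuous.
\<close>

lemma bdd_meas_primitive:
  assumes h: "h \<in> bdd_meas" shows "primitive h \<in> bdd_meas"
proof -
  note int = bdd_meas_set_integrable[OF h]
  have eq: "primitive h t = integral {0..t} h" if "t \<in> {0..1}" for t
    unfolding primitive_def using that
    by (intro set_lebesgue_integral_eq_integral(2) set_integrable_subset[OF int]) auto
  have "continuous_on {0..1} (\<lambda>t. integral {0..t} h)"
    using int by (intro indefinite_integral_continuous_1 set_lebesgue_integral_eq_integral(1))
  then show ?thesis using bdd_meas_cong[OF eq] bdd_meas_continuous by simp
qed

lemma sigma_finite_lebesgue: "sigma_finite_measure (lebesgue :: real measure)"
proof
  obtain A :: "real set set" where A: "countable A" "A \<subseteq> sets lborel" "\<Union>A = space lborel" "\<forall>a\<in>A. emeasure lborel a \<noteq> \<infinity>"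
    using lborel.sigma_finite_countable by blast
  then show "\<exists>A::real set set. countable A \<and> A \<subseteq> sets lebesgue \<and> \<Union>A = space lebesgue \<and> (\<forall>a\<in>A. emeasure lebesgue a \<noteq> \<infinity>)"
    by (intro exI[of _ A]) (auto simp: subset_iff)
qed

lemma poly_set_integral:
  fixes Q q :: "real poly"
  assumes "pderiv Q = q" "a \<le> b"
  shows "(LINT t:{a..b}|lebesgue. poly q t) = poly Q b - poly Q a"
proof -
  have "((poly q) has_integral (poly Q b - poly Q a)) {a..b}"
    using assms by (intro fundamental_theorem_of_calculus[where f = "poly Q"])
      (auto simp: has_real_derivative_iff_has_vector_derivative[symmetric] intro!: poly_DERIV[THEN has_field_derivative_at_within])
  moreover have "set_integrable lebesgue {a..b} (poly q)"
    by (intro absolutely_integrable_continuous_real continuous_intros)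
  ultimately show ?thesis
    by (simp add: set_lebesgue_integral_eq_integral(2) integral_unique)
qed

text \<open>
  Both sides are the integral of \<open>q t * h s\<close> over the triangle \<open>0 \<le> s \<le> t \<le> 1\<close>. The functions are
  cut off to the unit interval so that Fubini's theorem applies on the whole plane.
\<close>

lemma integral_poly_times_primitive:
  assumes h: "h \<in> bdd_meas" and Q: "pderiv Q = q"
  shows "(\<integral>t. poly q t * primitive h t \<partial>unit_leb) = (\<integral>s. h s * (poly Q 1 - poly Q s) \<partial>unit_leb)"
proof -
  interpret sigma_finite_measure "lebesgue :: real measure" by (rule sigma_finite_lebesgue)
  interpret pair_sigma_finite "lebesgue :: real measure" "lebesgue :: real measure" ..
  define q0 h0 where "q0 t = indicator {0..1} t * poly q t" and "h0 s = indicator {0..1} s * h s" for t s :: real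
  define K where "K t s = q0 t * (indicator {..t} s * h0 s)" for t s
  obtain B C where B: "\<forall>t\<in>{0..1}. \<bar>h t\<bar> \<le> B" and C: "\<forall>t\<in>{0..1}. \<bar>poly q t\<bar> \<le> C"
    using h bdd_meas_poly[of q] unfolding bdd_meas_def by blast
  then have BC: "0 \<le> B" "0 \<le> C"
    using abs_ge_zero[of "h 0"] abs_ge_zero[of "poly q 0"] by (fastforce dest: bspec[of _ _ 0])+
  have meas: "q0 \<in> borel_measurable lebesgue" "h0 \<in> borel_measurable lebesgue"
    using h bdd_meas_poly[of q] unfolding q0_def h0_def bdd_meas_def
    by (auto simp: borel_measurable_restrict_space_iff mult.commute)
  have id: "(\<lambda>x. x) \<in> borel_measurable (lebesgue :: real measure)"
    by (intro measurable_completion) simp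
  have fs: "fst \<in> borel_measurable (lebesgue \<Otimes>\<^sub>M lebesgue :: (real \<times> real) measure)"
    "snd \<in> borel_measurable (lebesgue \<Otimes>\<^sub>M lebesgue :: (real \<times> real) measure)"
    using measurable_compose[OF measurable_fst id] measurable_compose[OF measurable_snd id] by auto
  have K_eq: "(\<lambda>z. K (fst z) (snd z)) = (\<lambda>z. q0 (fst z) * (indicator {z. snd z \<le> fst z} z * h0 (snd z)))"
    by (auto simp: K_def fun_eq_iff indicator_def)
  have "(\<lambda>z. K (fst z) (snd z)) \<in> borel_measurable (lebesgue \<Otimes>\<^sub>M lebesgue)"
    unfolding K_eq using fs
    by (intro borel_measurable_times measurable_compose[OF measurable_fst meas(1)]
        measurable_compose[OF measurable_snd meas(2)] borel_measurable_indicator')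
       (auto intro: borel_measurable_le)
  then have "integrable (lebesgue \<Otimes>\<^sub>M lebesgue) (\<lambda>z. K (fst z) (snd z))"
  proof (intro integrableI_bounded_set[where A = "{0..1} \<times> {0..1}" and B = "C * B"])
    show "emeasure (lebesgue \<Otimes>\<^sub>M lebesgue) ({0..1::real} \<times> {0..1::real}) < \<infinity>"
      by (simp add: sigma_finite_measure.emeasure_pair_measure_Times[OF sigma_finite_lebesgue])
    have "\<bar>K t s\<bar> \<le> C * B" if "t \<in> {0..1}" "s \<in> {0..1}" for t s
      unfolding K_def abs_mult using that B C BC by (intro mult_mono) (auto simp: q0_def h0_def indicator_def)
    then show "AE z in lebesgue \<Otimes>\<^sub>M lebesgue. z \<in> {0..1} \<times> {0..1} \<longrightarrow> norm (K (fst z) (snd z)) \<le> C * B"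
      by (intro AE_I2) (auto simp: real_norm_def)
    show "AE z in lebesgue \<Otimes>\<^sub>M lebesgue. z \<notin> {0..1} \<times> {0..1} \<longrightarrow> K (fst z) (snd z) = 0"
      by (intro AE_I2) (auto simp: K_def q0_def h0_def indicator_def)
  qed simp
  then have "integrable (lebesgue \<Otimes>\<^sub>M lebesgue) (case_prod K)" by (simp add: case_prod_unfold)
  from Fubini_integral[OF this]
  have "(\<integral>t. \<integral>s. K t s \<partial>lebesgue \<partial>lebesgue) = (\<integral>s. \<integral>t. K t s \<partial>lebesgue \<partial>lebesgue)" by simp
  moreover have "(\<integral>s. K t s \<partial>lebesgue) = indicator {0..1} t *\<^sub>R (poly q t * primitive h t)" for t
  proof (cases "t \<in> {0..1}")
    case True
    then have "K t s = poly q t * (indicator {0..t} s *\<^sub>R h s)" for s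
      by (auto simp: K_def q0_def h0_def indicator_def)
    then show ?thesis using True by (simp add: primitive_def set_lebesgue_integral_def)
  qed (simp add: K_def q0_def)
  moreover have "(\<integral>t. K t s \<partial>lebesgue) = indicator {0..1} s *\<^sub>R (h s * (poly Q 1 - poly Q s))" for s
  proof (cases "s \<in> {0..1}")
    case True
    then have "K t s = h s * (indicator {s..1} t *\<^sub>R poly q t)" for t
      by (auto simp: K_def q0_def h0_def indicator_def)
    then show ?thesis using True poly_set_integral[OF Q, of s 1] by (simp add: set_lebesgue_integral_def)
  qed (simp add: K_def h0_def)
  ultimately show ?thesis by (simp add: integral_restrict_space)
qed

lemma exists_antiderivative: "\<exists>Q :: real poly. pderiv Q = q \<and> degree Q \<le> Suc (degree q)"
proof -
  define Q where "Q = (\<Sum>i\<le>degree q. monom (coeff q i / real (Suc i)) (Suc i))"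
  have "coeff Q (Suc n) = coeff q n / real (Suc n)" for n
    by (simp add: Q_def coeff_sum coeff_eq_0)
  then have "pderiv Q = q" by (intro poly_eqI) (simp add: coeff_pderiv)
  moreover have "degree Q \<le> Suc (degree q)"
    unfolding Q_def by (intro degree_sum_le) (auto intro: order.trans[OF degree_monom_le])
  ultimately show ?thesis by blast
qed

definition moment :: "(real \<Rightarrow> real) \<Rightarrow> real poly \<Rightarrow> real" where
  "moment h q = (\<integral>t. poly q t * h t \<partial>unit_leb)"

lemma moment_integrable: "h \<in> bdd_meas \<Longrightarrow> integrable unit_leb (\<lambda>t. poly q t * h t)"
  by (intro bdd_meas_integrable bdd_meas_mult bdd_meas_poly)

lemma moment_add: "h \<in> bdd_meas \<Longrightarrow> moment h (p + q) = moment h p + moment h q"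
  unfolding moment_def by (simp add: distrib_right moment_integrable)

lemma moment_smult: "moment h (smult k q) = k * moment h q"
  unfolding moment_def by (simp add: mult.assoc)

lemma moment_diff: "h \<in> bdd_meas \<Longrightarrow> moment h (p - q) = moment h p - moment h q"
  using moment_add[of h p "smult (-1) q"] moment_smult[of h "-1" q] by simp

lemma moment_sum: "h \<in> bdd_meas \<Longrightarrow> moment h (\<Sum>i\<in>A. p i) = (\<Sum>i\<in>A. moment h (p i))"
  by (induction A rule: infinite_finite_induct) (simp_all add: moment_add, simp_all add: moment_def)

lemma moment_poly_commute: "moment (poly p) q = moment (poly q) p"
  by (simp add: moment_def mult.commute)

lemma moment_square_pos:
  assumes "z \<noteq> 0" shows "0 < moment (poly z) z"
proof -
  have int: "set_integrable lebesgue {0..1} (\<lambda>t. poly z t * poly z t)"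
    by (intro bdd_meas_set_integrable bdd_meas_mult bdd_meas_poly)
  have eq: "moment (poly z) z = integral {0..1} (\<lambda>t. poly z t * poly z t)"
    unfolding moment_def set_integral_unit_leb[symmetric] by (rule set_lebesgue_integral_eq_integral(2)[OF int])
  have "\<not> {0..1} \<subseteq> {t. poly z t = 0}"
  proof
    assume "{0..1} \<subseteq> {t. poly z t = 0}"
    then have "finite {0..1::real}" using poly_roots_finite[OF assms] by (rule finite_subset)
    then show False using infinite_Icc[of 0 "1::real"] by simp
  qed
  then obtain t where "t \<in> {0..1}" "poly z t \<noteq> 0" by blast
  moreover have "integral {0..1} (\<lambda>t. poly z t * poly z t) = 0 \<longleftrightarrow> (\<forall>t\<in>{0..1}. poly z t * poly z t = 0)"
    using integral_cbox_eq_0_iff[of 0 1 "\<lambda>t. poly z t * poly z t"] by (simp add: continuous_intros)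
  ultimately have "integral {0..1} (\<lambda>t. poly z t * poly z t) \<noteq> 0" by (metis mult_eq_0_iff)
  moreover have "0 \<le> integral {0..1} (\<lambda>t. poly z t * poly z t)"
    by (intro integral_nonneg set_lebesgue_integral_eq_integral(1)[OF int]) auto
  ultimately show ?thesis by (simp add: eq)
qed

text \<open>
  The polynomial \<open>p\<close> is the \<open>L\<^sup>2\<close>-projection of \<open>h\<close>. In the induction, \<open>z\<close> is the monomial of
  degree \<open>e + 1\<close> minus its own projection, hence orthogonal to all polynomials of degree at most \<open>e\<close>, and a
  multiple of \<open>z\<close> corrects the one new moment.
\<close>

theorem moment_projection:
  assumes "h \<in> bdd_meas"
  shows "\<exists>p. degree p \<le> e \<and> (\<forall>q. degree q \<le> e \<longrightarrow> moment (poly p) q = moment h q)"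
  using assms
proof (induction e arbitrary: h)
  case 0
  have "moment (poly [:moment h 1:]) q = moment h q" if "degree q \<le> 0" for q
  proof -
    obtain a where "q = [:a:]" using \<open>degree q \<le> 0\<close> by (metis degree_eq_zeroE le_zero_eq)
    then show ?thesis by (simp add: moment_def measure_restrict_space)
  qed
  then show ?case by (intro exI[of _ "[:moment h 1:]"]) (auto simp del: poly_pCons)
next
  case (Suc e)
  define m :: "real poly" where "m = monom 1 (Suc e)"
  obtain p where p: "degree p \<le> e" "\<And>q. degree q \<le> e \<Longrightarrow> moment (poly p) q = moment h q"
    using Suc.IH[OF Suc.prems] by blast
  obtain r where r: "degree r \<le> e" "\<And>q. degree q \<le> e \<Longrightarrow> moment (poly r) q = moment (poly m) q"
    using Suc.IH[OF bdd_meas_poly[of m]] by blast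
  define z where "z = m - r"
  have "coeff z (Suc e) = 1" using r(1) by (simp add: z_def m_def coeff_eq_0)
  then have "z \<noteq> 0" by auto
  have orth: "moment (poly z) q = 0" if "degree q \<le> e" for q
    using r(2)[OF that] moment_diff[OF bdd_meas_poly[of q], of m r]
    by (simp add: z_def moment_poly_commute[of _ q])
  have "moment (poly z) z = moment (poly z) m - moment (poly z) r"
    using moment_diff[OF bdd_meas_poly[of z], of m r] by (simp add: z_def)
  with orth[OF r(1)] moment_square_pos[OF \<open>z \<noteq> 0\<close>] have mz: "moment (poly z) m > 0" by simp
  define k where "k = (moment h m - moment (poly p) m) / moment (poly z) m"
  define p' where "p' = p + smult k z"
  have p': "moment (poly p') q = moment (poly p) q + k * moment (poly z) q" for q
    by (simp add: moment_poly_commute[of _ q] p'_def moment_add[OF bdd_meas_poly] moment_smult)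
  have "degree z \<le> Suc e" unfolding z_def m_def using r(1)
    by (intro degree_diff_le degree_monom_le) auto
  then have "degree p' \<le> Suc e"
    unfolding p'_def using p(1) by (intro degree_add_le order.trans[OF degree_smult_le]) auto
  moreover have "moment (poly p') q = moment h q" if "degree q \<le> Suc e" for q
  proof -
    define q' where "q' = q - smult (coeff q (Suc e)) m"
    have "degree q' \<le> e"
    proof (rule degree_le, intro allI impI)
      fix i assume "e < i"
      then show "coeff q' i = 0" using that
        by (cases "i = Suc e") (auto simp: q'_def m_def coeff_eq_0)
    qed
    then have "moment (poly p') q' = moment h q'" by (simp add: p' orth p(2))
    moreover have "moment (poly p') m = moment h m" using mz by (simp add: p' k_def)
    ultimately show ?thesis
      using Suc.prems by (simp add: q'_def moment_diff moment_smult bdd_meas_poly)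
  qed
  ultimately show ?case by blast
qed

section \<open>The constraints and the objective in terms of moments\<close>

lemma moment_cong: "(\<And>t. t \<in> {0..1} \<Longrightarrow> f t = g t) \<Longrightarrow> moment f q = moment g q"
  unfolding moment_def by (intro Bochner_Integration.integral_cong) auto

lemma moment_0 [simp]: "moment h 0 = 0" by (simp add: moment_def)

lemma moment_add_fun:
  "f \<in> bdd_meas \<Longrightarrow> g \<in> bdd_meas \<Longrightarrow> moment (\<lambda>t. f t + g t) q = moment f q + moment g q"
  unfolding moment_def by (simp add: distrib_left moment_integrable)

lemma moment_sum_fun:
  "(\<And>i. i \<in> I \<Longrightarrow> f i \<in> bdd_meas) \<Longrightarrow> moment (\<lambda>t. \<Sum>i\<in>I. f i t) q = (\<Sum>i\<in>I. moment (f i) q)"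
  unfolding moment_def by (simp add: sum_distrib_left moment_integrable)

lemma moment_mult_fun: "moment (\<lambda>t. h t * poly p t) q = moment h (p * q)"
  unfolding moment_def by (simp add: mult_ac)

text \<open>
  The polynomial \<open>r\<close> is \<open>t ^ k * (Q 1 - Q t)\<close> with \<open>Q\<close> an antiderivative of \<open>q\<close>. The bound on its
  degree is where the summand \<open>d + 1 + deg D\<^sub>i\<close> of \<open>d_hat\<close> comes from.
\<close>

lemma moment_primitive:
  "\<exists>r. degree r \<le> k + (degree q + 1) \<and> (\<forall>h\<in>bdd_meas. moment (primitive (\<lambda>s. s ^ k * h s)) q = moment h r)"
proof -
  obtain Q where Q: "pderiv Q = q" "degree Q \<le> Suc (degree q)" using exists_antiderivative by blast
  define r where "r = monom 1 k * ([:poly Q 1:] - Q)"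
  have "degree r \<le> degree (monom 1 k :: real poly) + degree ([:poly Q 1:] - Q)" unfolding r_def by (rule degree_mult_le)
  also have "\<dots> \<le> k + (degree q + 1)"
    using Q(2) by (intro add_mono degree_diff_le) (auto simp: degree_monom_eq)
  finally have "degree r \<le> k + (degree q + 1)" .
  moreover have "moment (primitive (\<lambda>s. s ^ k * h s)) q = moment h r" if "h \<in> bdd_meas" for h
  proof -
    have "(\<lambda>s. s ^ k * h s) \<in> bdd_meas" using that by (intro bdd_meas_mult bdd_meas_power)
    from integral_poly_times_primitive[OF this Q(1)] show ?thesis
      by (simp add: moment_def r_def poly_monom mult_ac)
  qed
  ultimately show ?thesis by blast
qed

lemma Lvec_component:
  assumes "x \<in> Lvec" shows "(\<lambda>t. x t $ i) \<in> bdd_meas"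
proof -
  have "x \<in> borel_measurable unit_leb" using assms by (simp add: Lvec_def)
  moreover have "(\<lambda>v. v $ i) \<in> borel_measurable borel"
    by (intro borel_measurable_continuous_onI continuous_intros)
  ultimately have "(\<lambda>t. x t $ i) \<in> borel_measurable unit_leb" by (rule measurable_compose)
  then show ?thesis using assms by (auto simp: Lvec_def bdd_meas_def)
qed

lemma polyvec_subset_Lvec: "polyvec e \<subseteq> Lvec"
proof
  fix x :: "real \<Rightarrow> real ^ 'a" assume "x \<in> polyvec e"
  then obtain p where x: "x = vec_eval p" by (auto simp: polyvec_def)
  have cont: "continuous_on {0..1} x" unfolding x vec_eval_def[abs_def]
    by (intro continuous_intros)
  then have "bounded (x ` {0..1})" by (intro compact_imp_bounded compact_continuous_image) auto
  then obtain B where "\<forall>t\<in>{0..1}. norm (x t) \<le> B" by (auto simp: bounded_iff)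
  then have "\<forall>t\<in>{0..1}. \<forall>i. \<bar>x t $ i\<bar> \<le> B" using component_le_norm_cart order.trans by blast
  then show "x \<in> Lvec" using cont
    by (auto simp: Lvec_def intro!: continuous_imp_measurable_on_sets_lebesgue)
qed

lemma poly_ts_expand:
  assumes "degree p \<le> K"
  shows "poly_ts p t s = (\<Sum>k\<le>K. s ^ k * poly (coeff p k) t)"
proof -
  have "poly p [:s:] = (\<Sum>k\<le>K. coeff p k * [:s:] ^ k)"
    unfolding poly_altdef using assms by (intro sum.mono_neutral_left) (auto simp: coeff_eq_0)
  then show ?thesis by (simp add: poly_ts_def poly_sum poly_power mult.commute)
qed

text \<open>
  The kernel \<open>D i\<close> is expanded in powers of \<open>s\<close>, so that only primitives of functions of one variable
  occur. The common bound \<open>K\<close> lets all entries be expanded over the same range.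
\<close>

lemma F_op_entry:
  fixes D :: "'n::finite \<Rightarrow> real poly poly ^ 'm ^ 'm"
  assumes x: "x \<in> Lvec" and K: "\<And>i a b. degree (D i $ a $ b) \<le> K" and t: "t \<in> {0..1}"
  shows "F_op A0 A D x t $ a $ b = poly (A0 $ a $ b) t + (\<Sum>i\<in>UNIV. x t $ i * poly (A i $ a $ b) t)
    + (\<Sum>i\<in>UNIV. \<Sum>k\<le>K. primitive (\<lambda>s. s ^ k * x s $ i) t * poly (coeff (D i $ a $ b) k) t)"
proof -
  have "(LINT s:{0..t}|lebesgue. x s $ i *\<^sub>R mat_eval_ts (D i) t s) $ a $ b =
    (\<Sum>k\<le>K. primitive (\<lambda>s. s ^ k * x s $ i) t * poly (coeff (D i $ a $ b) k) t)" for i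
  proof -
    define M :: "nat \<Rightarrow> real ^ 'm ^ 'm" where "M k = (\<chi> a b. poly (coeff (D i $ a $ b) k) t)" for k
    have int: "integrable lebesgue (\<lambda>s. indicator {0..t} s *\<^sub>R (s ^ k * x s $ i))" for k
      using t bdd_meas_mult[OF bdd_meas_power[of k] Lvec_component[OF x, of i], THEN bdd_meas_set_integrable]
      unfolding set_integrable_def[symmetric] by (rule_tac set_integrable_subset) auto
    have "indicator {0..t} s *\<^sub>R x s $ i *\<^sub>R mat_eval_ts (D i) t s
      = (\<Sum>k\<le>K. (indicator {0..t} s *\<^sub>R (s ^ k * x s $ i)) *\<^sub>R M k)" for s
      by (simp add: vec_eq_iff mat_eval_ts_def M_def poly_ts_expand[OF K] sum_distrib_left mult_ac)
    then have "(LINT s:{0..t}|lebesgue. x s $ i *\<^sub>R mat_eval_ts (D i) t s)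
      = (\<Sum>k\<le>K. primitive (\<lambda>s. s ^ k * x s $ i) t *\<^sub>R M k)"
      unfolding set_lebesgue_integral_def primitive_def using int by simp
    then show ?thesis by (simp add: M_def)
  qed
  then show ?thesis by (simp add: F_op_def mat_eval_def)
qed

lemma obtain_degree_bound:
  fixes D :: "'n::finite \<Rightarrow> real poly poly ^ 'm ^ 'm"
  obtains K where "\<And>i a b. degree (D i $ a $ b) \<le> K"
proof
  fix i a b
  show "degree (D i $ a $ b) \<le> (MAX (i, a, b). degree (D i $ a $ b))"
    by (rule Max_ge) (auto intro!: image_eqI[where x = "(i, a, b)"])
qed

lemma F_op_entry_bdd_meas:
  fixes D :: "'n::finite \<Rightarrow> real poly poly ^ 'm ^ 'm"
  assumes x: "x \<in> Lvec" shows "(\<lambda>t. F_op A0 A D x t $ a $ b) \<in> bdd_meas"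
proof -
  obtain K where K: "\<And>i a b. degree (D i $ a $ b) \<le> K" using obtain_degree_bound[of D] by blast
  show ?thesis
    by (subst bdd_meas_cong[OF F_op_entry[OF x K]], assumption)
      (intro bdd_meas_add bdd_meas_sum bdd_meas_mult bdd_meas_poly bdd_meas_primitive
        bdd_meas_power Lvec_component[OF x])
qed

lemma symmetric_entries:
  assumes "transpose M = M" shows "M $ a $ b = M $ b $ a"
proof -
  have "M $ a $ b = transpose M $ a $ b" by (simp only: assms)
  then show ?thesis by (simp add: transpose_def)
qed

lemma F_op_entry_sym:
  fixes D :: "'n::finite \<Rightarrow> real poly poly ^ 'm ^ 'm"
  assumes x: "x \<in> Lvec" and t: "t \<in> {0..1}"
    and sym: "transpose A0 = A0" "\<And>i. transpose (A i) = A i" "\<And>i. transpose (D i) = D i"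
  shows "F_op A0 A D x t $ a $ b = F_op A0 A D x t $ b $ a"
proof -
  obtain K where K: "\<And>i a b. degree (D i $ a $ b) \<le> K" using obtain_degree_bound[of D] by blast
  have "A0 $ a $ b = A0 $ b $ a" "\<And>i. A i $ a $ b = A i $ b $ a" "\<And>i. D i $ a $ b = D i $ b $ a"
    by (rule symmetric_entries, rule sym)+
  then show ?thesis by (simp only: F_op_entry[OF x K t])
qed

lemma moment_F_op_entry:
  fixes D :: "'n::finite \<Rightarrow> real poly poly ^ 'm ^ 'm"
  assumes x: "x \<in> Lvec" and K: "\<And>i a b. degree (D i $ a $ b) \<le> K"
  shows "moment (\<lambda>t. F_op A0 A D x t $ a $ b) q = moment (poly (A0 $ a $ b)) q
    + (\<Sum>i\<in>UNIV. moment (\<lambda>t. x t $ i) (A i $ a $ b * q))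
    + (\<Sum>i\<in>UNIV. \<Sum>k\<le>K. moment (primitive (\<lambda>s. s ^ k * x s $ i)) (coeff (D i $ a $ b) k * q))"
proof -
  note bdd = bdd_meas_sum bdd_meas_add bdd_meas_mult bdd_meas_poly bdd_meas_primitive bdd_meas_power Lvec_component[OF x]
  show ?thesis
    by (subst moment_cong[OF F_op_entry[OF x K]], assumption)
      (simp add: moment_add_fun moment_sum_fun bdd moment_mult_fun)
qed

lemma constraint_as_moments:
  fixes D :: "'n::finite \<Rightarrow> real poly poly ^ 'm ^ 'm"
  assumes x: "x \<in> Lvec"
  shows "(LINT t:{0..1}|lebesgue. trace (F_op A0 A D x t ** mat_eval P t)) =
    (\<Sum>a\<in>UNIV. \<Sum>b\<in>UNIV. moment (\<lambda>t. F_op A0 A D x t $ a $ b) (P $ b $ a))"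
proof -
  have "trace (F_op A0 A D x t ** mat_eval P t) =
    (\<Sum>a\<in>UNIV. \<Sum>b\<in>UNIV. poly (P $ b $ a) t * F_op A0 A D x t $ a $ b)" for t
    by (simp add: trace_def matrix_matrix_mult_def mat_eval_def mult.commute)
  then show ?thesis unfolding set_integral_unit_leb
    by (simp add: moment_def moment_integrable F_op_entry_bdd_meas[OF x])
qed

lemma objective_as_moments:
  assumes x: "x \<in> Lvec"
  shows "objective c x = (\<Sum>i\<in>UNIV. moment (\<lambda>t. x t $ i) (c $ i))"
  unfolding objective_def set_integral_unit_leb
  by (simp add: inner_vec_def vec_eval_def moment_def moment_integrable Lvec_component[OF x])

text \<open>
  The quadratic form of this matrix at the coefficients of a polynomial vector \<open>q\<close> is the value of
  the functional at \<open>w q q\<^sup>T\<close>.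
\<close>

lemma psd_Lambda_adj_iff:
  fixes F :: "real \<Rightarrow> real ^ 'm ^ 'm"
  assumes F: "\<And>a b. (\<lambda>t. F t $ a $ b) \<in> bdd_meas"
    and sym: "\<And>t a b. t \<in> {0..1} \<Longrightarrow> F t $ a $ b = F t $ b $ a"
  shows "psd (Lambda_adj e (\<lambda>t. poly w t *\<^sub>R F t)) \<longleftrightarrow>
    (\<forall>q. (\<forall>a. degree (q a) \<le> e div 2) \<longrightarrow>
      0 \<le> (\<Sum>a\<in>UNIV. \<Sum>b\<in>UNIV. moment (\<lambda>t. F t $ a $ b) (w * (q a * q b))))"
proof -
  let ?N = "e div 2"
  define M where "M = (\<lambda>(a, k) (b, l). moment (\<lambda>t. F t $ a $ b) (w * monom 1 (k + l)))"
  have Lam: "Lambda_adj e (\<lambda>t. poly w t *\<^sub>R F t) = (UNIV \<times> {0..?N}, M)"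
    unfolding Lambda_adj_def M_def moment_def set_integral_unit_leb
    by (simp add: poly_monom mult_ac)
  have M_sym: "M p q = M q p" for p q
    by (cases p; cases q) (auto simp: M_def add.commute sym intro!: moment_cong)
  have form: "(\<Sum>p\<in>UNIV \<times> {0..?N}. \<Sum>q\<in>UNIV \<times> {0..?N}. v p * M p q * v q) =
    (\<Sum>a\<in>UNIV. \<Sum>b\<in>UNIV. moment (\<lambda>t. F t $ a $ b) (w * ((\<Sum>k=0..?N. monom (v (a, k)) k) * (\<Sum>k=0..?N. monom (v (b, k)) k))))"
    for v
  proof -
    have "moment (\<lambda>t. F t $ a $ b) (w * ((\<Sum>k=0..?N. monom (v (a, k)) k) * (\<Sum>k=0..?N. monom (v (b, k)) k)))
      = (\<Sum>k=0..?N. \<Sum>l=0..?N. v (a, k) * M (a, k) (b, l) * v (b, l))" for a b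
    proof -
      have "w * ((\<Sum>k=0..?N. monom (v (a, k)) k) * (\<Sum>k=0..?N. monom (v (b, k)) k)) =
        (\<Sum>k=0..?N. \<Sum>l=0..?N. smult (v (a, k) * v (b, l)) (w * monom 1 (k + l)))"
      proof -
        have sm: "smult k (w * monom 1 n) = w * monom k n" for k n
          by (simp add: smult_monom flip: mult_smult_right)
        show ?thesis unfolding sum_product by (simp add: sm sum_distrib_left mult_monom)
      qed
      then show ?thesis by (simp add: moment_sum[OF F] moment_smult M_def mult_ac)
    qed
    then have "(\<Sum>a\<in>UNIV. \<Sum>b\<in>UNIV. moment (\<lambda>t. F t $ a $ b) (w * ((\<Sum>k=0..?N. monom (v (a, k)) k) * (\<Sum>k=0..?N. monom (v (b, k)) k))))
      = (\<Sum>a\<in>UNIV. \<Sum>b\<in>UNIV. \<Sum>k=0..?N. \<Sum>l=0..?N. v (a, k) * M (a, k) (b, l) * v (b, l))" by simp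
    also have "\<dots> = (\<Sum>a\<in>UNIV. \<Sum>k=0..?N. \<Sum>b\<in>UNIV. \<Sum>l=0..?N. v (a, k) * M (a, k) (b, l) * v (b, l))"
      by (intro sum.cong refl sum.swap)
    finally show ?thesis by (simp add: sum.cartesian_product')
  qed
  show ?thesis
  proof
    assume "psd (Lambda_adj e (\<lambda>t. poly w t *\<^sub>R F t))"
    then have nn: "0 \<le> (\<Sum>p\<in>UNIV \<times> {0..?N}. \<Sum>q\<in>UNIV \<times> {0..?N}. v p * M p q * v q)" for v
      by (simp add: Lam psd_def)
    show "\<forall>q. (\<forall>a. degree (q a) \<le> ?N) \<longrightarrow>
      0 \<le> (\<Sum>a\<in>UNIV. \<Sum>b\<in>UNIV. moment (\<lambda>t. F t $ a $ b) (w * (q a * q b)))"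
    proof (intro allI impI)
      fix q :: "'m \<Rightarrow> real poly" assume "\<forall>a. degree (q a) \<le> ?N"
      then have "(\<Sum>k=0..?N. monom (coeff (q a) k) k) = q a" for a
        using poly_as_sum_of_monoms'[of "q a" ?N] by (simp add: atMost_atLeast0)
      then show "0 \<le> (\<Sum>a\<in>UNIV. \<Sum>b\<in>UNIV. moment (\<lambda>t. F t $ a $ b) (w * (q a * q b)))"
        using nn[of "\<lambda>(a, k). coeff (q a) k"] by (simp add: form)
    qed
  next
    assume nn: "\<forall>q. (\<forall>a. degree (q a) \<le> ?N) \<longrightarrow>
      0 \<le> (\<Sum>a\<in>UNIV. \<Sum>b\<in>UNIV. moment (\<lambda>t. F t $ a $ b) (w * (q a * q b)))"
    have "degree (\<Sum>k=0..?N. monom (v (a, k)) k) \<le> ?N" for v :: "'m \<times> nat \<Rightarrow> real" and a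
      by (intro degree_sum_le) (auto intro: order.trans[OF degree_monom_le])
    then have "0 \<le> (\<Sum>p\<in>UNIV \<times> {0..?N}. \<Sum>q\<in>UNIV \<times> {0..?N}. v p * M p q * v q)" for v
      unfolding form using nn[rule_format, of "\<lambda>a. \<Sum>k=0..?N. monom (v (a, k)) k"] by simp
    then show "psd (Lambda_adj e (\<lambda>t. poly w t *\<^sub>R F t))"
      by (simp add: Lam psd_def M_sym)
  qed
qed

text \<open>
  The exponents of the weight and the bound on \<open>q\<close> are such that, for \<open>c \<le> d\<close>, the weighted square
  has degree at most \<open>d\<close>. For \<open>c = 0, 1\<close> the weights are \<open>1\<close> and \<open>t(1-t)\<close> if \<open>d\<close> is even, and \<open>1-t\<close> and \<open>t\<close> if
  \<open>d\<close> is odd.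
\<close>

definition nonneg_on_squares :: "nat \<Rightarrow> (real \<Rightarrow> real ^ 'm ^ 'm) \<Rightarrow> nat \<Rightarrow> bool" where
  "nonneg_on_squares d F c \<longleftrightarrow> (\<forall>q. (\<forall>a. degree (q a) \<le> (d - c) div 2) \<longrightarrow>
     0 \<le> (\<Sum>a\<in>UNIV. \<Sum>b\<in>UNIV. moment (\<lambda>t. F t $ a $ b) ([:0, 1:] ^ c * [:1, -1:] ^ ((d - c) mod 2) * (q a * q b))))"

lemma psd_alpha_beta_iff:
  fixes F :: "real \<Rightarrow> real ^ 'm ^ 'm"
  assumes F: "\<And>a b. (\<lambda>t. F t $ a $ b) \<in> bdd_meas"
    and sym: "\<And>t a b. t \<in> {0..1} \<Longrightarrow> F t $ a $ b = F t $ b $ a"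
  shows "psd (alpha_adj d F) \<and> (d > 0 \<longrightarrow> psd (beta_adj d F)) \<longleftrightarrow> (\<forall>c\<le>min 1 d. nonneg_on_squares d F c)"
proof -
  note iff = psd_Lambda_adj_iff[OF F sym, of _ _]
  have c: "(\<forall>c\<le>min 1 d. Q c) \<longleftrightarrow> Q 0 \<and> (d > 0 \<longrightarrow> Q 1)" for Q
    by (cases d) (auto simp: le_Suc_eq)
  show ?thesis
  proof (cases "odd d")
    case True
    then have d: "d mod 2 = 1" "(d - 1) mod 2 = 0" "d div 2 = (d - 1) div 2" "d > 0" by (auto elim: oddE)
    have "psd (alpha_adj d F) \<longleftrightarrow> nonneg_on_squares d F 1"
      using iff[of "d - 1" "[:0, 1:]"] True d by (simp add: alpha_adj_def nonneg_on_squares_def)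
    moreover have "psd (beta_adj d F) \<longleftrightarrow> nonneg_on_squares d F 0"
      using iff[of "d - 1" "[:1, -1:]"] True d by (simp add: beta_adj_def nonneg_on_squares_def)
    ultimately show ?thesis unfolding c using d by auto
  next
    case False
    have "psd (alpha_adj d F) \<longleftrightarrow> nonneg_on_squares d F 0"
      using iff[of d 1] False by (simp add: alpha_adj_def nonneg_on_squares_def)
    moreover have "psd (beta_adj d F) \<longleftrightarrow> nonneg_on_squares d F 1" if "d > 0"
    proof -
      have d: "(d - 1) mod 2 = 1" "(d - 1) div 2 = (d - 2) div 2" using that False by presburger+
      have w: "poly ([:0, 1:] * [:1, -1:]) t = t * (1 - t)" for t :: real by simp
      show ?thesis
        using iff[of "d - 2" "[:0, 1:] * [:1, -1:]"] False d unfolding w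
        by (simp add: beta_adj_def nonneg_on_squares_def del: mult_pCons_left mult_pCons_right)
    qed
    ultimately show ?thesis unfolding c by auto
  qed
qed

lemma weighted_square_in_Splus:
  fixes q :: "'m::finite \<Rightarrow> real poly"
  assumes c: "c \<le> d" and q: "\<And>a. degree (q a) \<le> (d - c) div 2"
  shows "(\<chi> a b. [:0, 1:] ^ c * [:1, -1:] ^ ((d - c) mod 2) * (q a * q b)) \<in> Splus d"
proof -
  let ?w = "[:0, 1:] ^ c * [:1, -1:] ^ ((d - c) mod 2) :: real poly"
  have "degree (?w * (q a * q b)) \<le> d" for a b
  proof -
    have "degree (?w * (q a * q b)) \<le> (degree ([:0, 1 :: real:] ^ c) + degree ([:1, -1 :: real:] ^ ((d - c) mod 2))) + (degree (q a) + degree (q b))"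
      by (intro order.trans[OF degree_mult_le] add_mono degree_mult_le)
    also have "\<dots> \<le> (c + (d - c) mod 2) + ((d - c) div 2 + (d - c) div 2)"
      using q by (intro add_mono) (auto simp: degree_power_eq)
    also have "\<dots> = d" using c mod_mult_div_eq[of "d - c" 2] by linarith
    finally show ?thesis .
  qed
  moreover have "psd (fmat_of (mat_eval (\<chi> a b. ?w * (q a * q b)) t))" if t: "t \<in> {0..1}" for t
  proof -
    have "(\<Sum>a\<in>UNIV. \<Sum>b\<in>UNIV. v a * poly (?w * (q a * q b)) t * v b) = poly ?w t * (\<Sum>a\<in>UNIV. v a * poly (q a) t)\<^sup>2" for v
      by (simp add: power2_eq_square sum_product sum_distrib_left mult_ac)
    moreover have "0 \<le> poly ?w t" using t by (simp add: poly_power)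
    ultimately show ?thesis
      by (simp add: psd_def fmat_of_def mat_eval_def mult_ac del: poly_mult poly_power)
  qed
  ultimately show ?thesis by (simp add: Splus_def transpose_def vec_eq_iff mult_ac)
qed

text \<open>
  Weighted squares are admissible \<open>P\<close>; conversely, nonnegativity on them extends to all of
  \<open>Splus d\<close> by \<open>nonneg_on_psd_polynomials_unit_interval\<close>.
\<close>

lemma constraint_iff_nonneg_on_squares:
  fixes D :: "'n::finite \<Rightarrow> real poly poly ^ 'm ^ 'm"
  assumes x: "x \<in> Lvec"
    and sym: "transpose A0 = A0" "\<And>i. transpose (A i) = A i" "\<And>i. transpose (D i) = D i"
  shows "(\<forall>P\<in>Splus d. 0 \<le> (LINT t:{0..1}|lebesgue. trace (F_op A0 A D x t ** mat_eval P t)))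
    \<longleftrightarrow> (\<forall>c\<le>min 1 d. nonneg_on_squares d (F_op A0 A D x) c)"
  (is "?constraint \<longleftrightarrow> ?squares")
proof
  let ?F = "F_op A0 A D x"
  note F = F_op_entry_bdd_meas[OF x, of A0 A D] and F_sym = F_op_entry_sym[OF x _ sym]
  {
    assume C: ?constraint
    show ?squares
      unfolding nonneg_on_squares_def
    proof (intro allI impI)
      fix c and q :: "'m \<Rightarrow> real poly"
      assume "c \<le> min 1 d" "\<forall>a. degree (q a) \<le> (d - c) div 2"
      define P :: "real poly ^ 'm ^ 'm" where
        "P = (\<chi> a b. [:0, 1:] ^ c * [:1, -1:] ^ ((d - c) mod 2) * (q a * q b))"
      have "P \<in> Splus d" unfolding P_def
        using \<open>c \<le> min 1 d\<close> \<open>\<forall>a. degree (q a) \<le> (d - c) div 2\<close> by (intro weighted_square_in_Splus) simp_all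
      from bspec[OF C this] have "0 \<le> (\<Sum>a\<in>UNIV. \<Sum>b\<in>UNIV. moment (\<lambda>t. ?F t $ a $ b) (P $ b $ a))"
        unfolding constraint_as_moments[OF x] .
      moreover have "P $ b $ a = [:0, 1:] ^ c * [:1, -1:] ^ ((d - c) mod 2) * (q a * q b)" for a b
        by (simp only: P_def vec_lambda_beta mult.commute[of "q b" "q a"])
      ultimately show "0 \<le> (\<Sum>a\<in>UNIV. \<Sum>b\<in>UNIV. moment (\<lambda>t. ?F t $ a $ b)
        ([:0, 1:] ^ c * [:1, -1:] ^ ((d - c) mod 2) * (q a * q b)))"
        by (simp only:)
    qed
  }
  {
    assume S: ?squares
    show ?constraint
    proof
      fix P :: "real poly ^ 'm ^ 'm" assume P: "P \<in> Splus d"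
      have P_sym: "P $ a $ b = P $ b $ a" for a b
        using P by (intro symmetric_entries) (simp add: Splus_def)
      have "0 \<le> (\<Sum>a\<in>UNIV. \<Sum>b\<in>UNIV. moment (\<lambda>t. ?F t $ a $ b) (P $ a $ b))"
      proof (rule nonneg_on_psd_polynomials_unit_interval[where d = d
            and L = "\<lambda>p a b. moment (\<lambda>t. ?F t $ a $ b) p" and P = "\<lambda>a b. P $ a $ b"])
        show "moment (\<lambda>t. ?F t $ a $ b) p = moment (\<lambda>t. ?F t $ b $ a) p" for p a b
          by (intro moment_cong F_sym)
        show "0 \<le> (\<Sum>a\<in>UNIV. \<Sum>b\<in>UNIV. moment (\<lambda>t. ?F t $ a $ b) ([:0, 1:] ^ c * [:1, -1:] ^ ((d - c) mod 2) * (q a * q b)))"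
          if "c \<le> min 1 d" "\<And>a. degree (q a) \<le> (d - c) div 2" for c q
          using S[rule_format, OF that(1)] that(2) unfolding nonneg_on_squares_def by (elim allE impE) simp_all
        show "degree (P $ a $ b) \<le> d" for a b using P by (auto simp: Splus_def)
        show "0 \<le> (\<Sum>a\<in>UNIV. \<Sum>b\<in>UNIV. poly (P $ a $ b) t * (w a * w b))" if "0 \<le> t" "t \<le> 1" for t w
        proof -
          have "psd (fmat_of (mat_eval P t))" using P that by (simp add: Splus_def)
          then show ?thesis by (simp add: psd_def fmat_of_def mat_eval_def mult_ac)
        qed
      qed (simp_all add: moment_add[OF F] moment_smult)
      also have "\<dots> = (\<Sum>a\<in>UNIV. \<Sum>b\<in>UNIV. moment (\<lambda>t. ?F t $ a $ b) (P $ b $ a))"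
        by (rule sum.cong[OF refl], rule sum.cong[OF refl], rule arg_cong[OF P_sym])
      finally show "0 \<le> (LINT t:{0..1}|lebesgue. trace (?F t ** mat_eval P t))"
        unfolding constraint_as_moments[OF x] .
    qed
  }
qed

lemma degree_le_mat_degree: "degree (M $ a $ b) \<le> mat_degree M"
  unfolding mat_degree_def by (rule Max_ge) (auto intro!: image_eqI[where x = "(a, b)"])

lemma degree_le_vec_degree: "degree (p $ i) \<le> vec_degree p"
  unfolding vec_degree_def by (rule Max_ge) auto

lemma degree_coeff_le_mat_total_degree:
  assumes "coeff (M $ a $ b) k \<noteq> 0"
  shows "k + degree (coeff (M $ a $ b) k) \<le> mat_total_degree M"
proof -
  have "finite {k. coeff (M $ a $ b) k \<noteq> 0}"
    by (rule finite_subset[of _ "{..degree (M $ a $ b)}"]) (auto intro: le_degree)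
  then have "k + degree (coeff (M $ a $ b) k) \<le> total_degree (M $ a $ b)"
    unfolding total_degree_def using assms by (intro Max_ge) auto
  also have "\<dots> \<le> mat_total_degree M"
    unfolding mat_total_degree_def by (rule Max_ge) (auto intro!: image_eqI[where x = "(a, b)"])
  finally show ?thesis .
qed

lemma d_hat_bounds:
  fixes A :: "'n::finite \<Rightarrow> real poly ^ 'm ^ 'm"
  shows "c \<noteq> 0 \<Longrightarrow> vec_degree c \<le> d_hat c A D d"
    and "A i \<noteq> 0 \<Longrightarrow> d + mat_degree (A i) \<le> d_hat c A D d"
    and "D i \<noteq> 0 \<Longrightarrow> d + 1 + mat_total_degree (D i) \<le> d_hat c A D d"
  unfolding d_hat_def by (rule Max_ge; auto)+

text \<open>
  Each weight that \<open>x\<^sub>i\<close> is integrated against is bounded in degree by one of the terms of \<open>d_hat\<close>.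
  Zero data give zero weights, so it does no harm that \<open>d_hat\<close> ignores them.
\<close>

lemma values_determined_by_moments:
  fixes D :: "'n::finite \<Rightarrow> real poly poly ^ 'm ^ 'm"
  assumes x: "x \<in> Lvec" and y: "y \<in> Lvec"
    and same: "\<And>i q. degree q \<le> d_hat c A D d \<Longrightarrow> moment (\<lambda>t. x t $ i) q = moment (\<lambda>t. y t $ i) q"
  shows "objective c x = objective c y"
    and "P \<in> Splus d \<Longrightarrow> (LINT t:{0..1}|lebesgue. trace (F_op A0 A D x t ** mat_eval P t)) =
      (LINT t:{0..1}|lebesgue. trace (F_op A0 A D y t ** mat_eval P t))"
proof -
  have "moment (\<lambda>t. x t $ i) (c $ i) = moment (\<lambda>t. y t $ i) (c $ i)" for i
  proof (cases "c = 0")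
    case False
    show ?thesis
      by (intro same order.trans[OF degree_le_vec_degree d_hat_bounds(1)] False)
  qed simp
  then show "objective c x = objective c y" by (simp add: objective_as_moments x y)
next
  assume P: "P \<in> Splus d"
  obtain K where K: "\<And>i a b. degree (D i $ a $ b) \<le> K" using obtain_degree_bound[of D] by blast
  have "moment (\<lambda>t. F_op A0 A D x t $ a $ b) q = moment (\<lambda>t. F_op A0 A D y t $ a $ b) q"
    if q: "degree q \<le> d" for a b q
  proof -
    have "moment (\<lambda>t. x t $ i) (A i $ a $ b * q) = moment (\<lambda>t. y t $ i) (A i $ a $ b * q)" for i
    proof (cases "A i = 0")
      case False
      have "degree (A i $ a $ b * q) \<le> mat_degree (A i) + d"
        by (intro order.trans[OF degree_mult_le] add_mono degree_le_mat_degree q)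
      then show ?thesis using d_hat_bounds(2)[where A = A and i = i, OF False, of d c D] by (intro same) simp
    qed simp
    moreover have "moment (primitive (\<lambda>s. s ^ k * x s $ i)) (coeff (D i $ a $ b) k * q) =
      moment (primitive (\<lambda>s. s ^ k * y s $ i)) (coeff (D i $ a $ b) k * q)" for i k
    proof (cases "coeff (D i $ a $ b) k = 0")
      case False
      then have "D i \<noteq> 0" by auto
      obtain r where r: "degree r \<le> k + (degree (coeff (D i $ a $ b) k * q) + 1)"
        "\<And>h. h \<in> bdd_meas \<Longrightarrow> moment (primitive (\<lambda>s. s ^ k * h s)) (coeff (D i $ a $ b) k * q) = moment h r"
        using moment_primitive[of k "coeff (D i $ a $ b) k * q"] by blast
      have "degree (coeff (D i $ a $ b) k * q) \<le> degree (coeff (D i $ a $ b) k) + d"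
        by (intro order.trans[OF degree_mult_le] add_mono q order.refl)
      then have "degree r \<le> d_hat c A D d"
        using r(1) degree_coeff_le_mat_total_degree[OF False] d_hat_bounds(3)[where D = D and i = i, OF \<open>D i \<noteq> 0\<close>, of d c A]
        by linarith
      then show ?thesis using same by (simp add: r(2) Lvec_component x y)
    qed simp
    ultimately show ?thesis by (simp add: moment_F_op_entry[OF _ K] x y)
  qed
  moreover have "degree (P $ b $ a) \<le> d" for a b using P by (simp add: Splus_def)
  ultimately show "(LINT t:{0..1}|lebesgue. trace (F_op A0 A D x t ** mat_eval P t)) =
      (LINT t:{0..1}|lebesgue. trace (F_op A0 A D y t ** mat_eval P t))"
    by (simp add: constraint_as_moments x y)
qed

lemma polyvec_projection:
  assumes x: "x \<in> Lvec"
  obtains y where "y \<in> polyvec e"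
    "\<And>i q. degree q \<le> e \<Longrightarrow> moment (\<lambda>t. x t $ i) q = moment (\<lambda>t. y t $ i) q"
proof -
  obtain p where p: "\<And>i. degree (p i) \<le> e" "\<And>i q. degree q \<le> e \<Longrightarrow> moment (poly (p i)) q = moment (\<lambda>t. x t $ i) q"
    using moment_projection[OF Lvec_component[OF x], of e] by metis
  show thesis
  proof (rule that[of "vec_eval (\<chi> i. p i)"])
    show "vec_eval (\<chi> i. p i) \<in> polyvec e"
      using p(1) unfolding polyvec_def by (auto intro!: exI[of _ "\<chi> i. p i"])
    show "moment (\<lambda>t. x t $ i) q = moment (\<lambda>t. vec_eval (\<chi> i. p i) t $ i) q" if "degree q \<le> e" for i q
      using p(2)[OF that] by (simp add: vec_eval_def)
  qed
qed

theorem theorem8: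
  fixes c :: "real poly ^ 'n"
    and A0 :: "real poly ^ 'm ^ 'm"
    and A :: "'n \<Rightarrow> real poly ^ 'm ^ 'm"
    and D :: "'n \<Rightarrow> real poly poly ^ 'm ^ 'm"
    and d :: nat
  assumes "transpose A0 = A0"
    and "\<And>i. transpose (A i) = A i"
    and "\<And>i. transpose (D i) = D i"
  shows "u_value c A0 A D d (polyvec (d_hat c A D d)) = u_value c A0 A D d Lvec \<and>
         u_value c A0 A D d Lvec = sdp_value c A0 A D d"
proof -
  let ?e = "d_hat c A D d"
  define feas where "feas X = {x \<in> X. \<forall>P\<in>Splus d.
    0 \<le> (LINT t:{0..1}|lebesgue. trace (F_op A0 A D x t ** mat_eval P t))}" for X
  have u: "u_value c A0 A D d X = Sup (ereal ` objective c ` feas X)" for X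
    by (simp add: u_value_def feas_def image_image)
  have "objective c ` feas (polyvec ?e) = objective c ` feas Lvec"
  proof (rule equalityI; rule image_subsetI)
    fix x assume "x \<in> feas (polyvec ?e)"
    then have "x \<in> feas Lvec" using polyvec_subset_Lvec by (auto simp: feas_def)
    then show "objective c x \<in> objective c ` feas Lvec" by (rule imageI)
  next
    fix x assume "x \<in> feas Lvec"
    then have x: "x \<in> Lvec" and feasible: "\<And>P. P \<in> Splus d \<Longrightarrow>
      0 \<le> (LINT t:{0..1}|lebesgue. trace (F_op A0 A D x t ** mat_eval P t))" by (auto simp: feas_def)
    obtain y where y: "y \<in> polyvec ?e"
      and same: "\<And>i q. degree q \<le> ?e \<Longrightarrow> moment (\<lambda>t. x t $ i) q = moment (\<lambda>t. y t $ i) q"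
      using polyvec_projection[OF x] by blast
    have yL: "y \<in> Lvec" using y polyvec_subset_Lvec by blast
    have objective: "objective c x = objective c y"
      by (rule values_determined_by_moments(1)[OF x yL, of c A D d]) (rule same)
    have constraint: "(LINT t:{0..1}|lebesgue. trace (F_op A0 A D x t ** mat_eval P t)) =
      (LINT t:{0..1}|lebesgue. trace (F_op A0 A D y t ** mat_eval P t))" if "P \<in> Splus d" for P
      by (rule values_determined_by_moments(2)[OF x yL, of c A D d]) (erule same, rule that)
    have "0 \<le> (LINT t:{0..1}|lebesgue. trace (F_op A0 A D y t ** mat_eval P t))" if "P \<in> Splus d" for P
      using feasible[OF that] unfolding constraint[OF that] .
    then have "y \<in> feas (polyvec ?e)" unfolding feas_def using y by (intro CollectI conjI ballI)
    then show "objective c x \<in> objective c ` feas (polyvec ?e)" unfolding objective by (rule imageI)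
  qed
  then have 1: "u_value c A0 A D d (polyvec ?e) = u_value c A0 A D d Lvec"
    unfolding u by (simp only:)
  have feas_iff: "(\<forall>P\<in>Splus d. 0 \<le> (LINT t:{0..1}|lebesgue. trace (F_op A0 A D x t ** mat_eval P t))) \<longleftrightarrow>
    psd (alpha_adj d (F_op A0 A D x)) \<and> (d > 0 \<longrightarrow> psd (beta_adj d (F_op A0 A D x)))"
    if "x \<in> polyvec ?e" for x
  proof -
    have x: "x \<in> Lvec" using that polyvec_subset_Lvec by blast
    show ?thesis
      unfolding constraint_iff_nonneg_on_squares[OF x assms]
      by (rule psd_alpha_beta_iff[OF F_op_entry_bdd_meas[OF x] F_op_entry_sym[OF x _ assms], symmetric])
  qed
  have "feas (polyvec ?e) = {x \<in> polyvec ?e.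
    psd (alpha_adj d (F_op A0 A D x)) \<and> (d > 0 \<longrightarrow> psd (beta_adj d (F_op A0 A D x)))}"
    unfolding feas_def by (rule Collect_cong, rule conj_cong[OF refl], rule feas_iff)
  then have "u_value c A0 A D d (polyvec ?e) = sdp_value c A0 A D d"
    unfolding u sdp_value_def image_image by (simp only:)
  with 1 show ?thesis by (simp only:)
qed

end
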